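(* Let $n,m$ be positive integers, let $W$ be a symmetric $BGW(n+1,n,n-1)$ with zero diagonal entries over the cyclic group $C_m=\langle U\rangle$, and let $T$ be the character table of the association scheme $\{A_{l,0},A_{l,1}\mid l=0,\dots,m-1\}$ constructed from $W$ in the context, with columns ordered as $A_{0,0},\dots,A_{m-1,0},A_{0,1},\dots,A_{m-1,1}$. Then, up to the ordering of the irreducible representations: (1) If $m$ is even, then $$T=\begin{pmatrix}\chi_0^\top & n\chi_0^\top\\ \chi_0^\top & -\chi_0^\top\\ \chi_{m/2}^\top & \sqrt n\,\chi_{m/2}^\top\\ \chi_{m/2}^\top & -\sqrt n\,\chi_{m/2}^\top\\ \chi_1^\top+\chi_{m-1}^\top & \mathbf 0^\top\\ \chi_2^\top+\chi_{m-2}^\top & \mathbf 0^\top\\ \vdots&\vdots\\ \chi_{m/2-1}^\top+\chi_{m/2+1}^\top & \mathbf 0^\top\end{pmatrix}.$$ (2) If $m$ is odd, then $$T=\begin{pmatrix}\chi_0^\top & n\chi_0^\top\\ \chi_0^\top & -\chi_0^\top\\ \chi_1^\top+\chi_{m-1}^\top & \mathbf 0^\top\\ \chi_2^\top+\chi_{m-2}^\top & \mathbf 0^\top\\ \vdots&\vdots\\ \chi_{(m-1)/2}^\top+\chi_{(m+1)/2}^\top & \mathbf 0^\top\end{pmatrix}.$$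
   Context: $I_r$, $J_r$: identity and all-ones matrices of order $r$. The adjacency algebra $\mathcal{A}$ of an association scheme $\{A_0,\dots,A_d\}$ is the complex span of the $A_i$; it is semisimple, $\mathcal{A}\cong\bigoplus_k\mathrm{Mat}_{d_k}(\mathbb{C})$. Let $\varphi_k:\mathcal{A}\to\mathrm{Mat}_{d_k}(\mathbb{C})$ be the corresponding (pairwise inequivalent) irreducible representations; the character table $T$ is the matrix with $(k,i)$-entry $\mathrm{tr}(\varphi_k(A_i))$. For a finite multiplicative group $G$, a $BGW(v,k,\lambda)$ over $G$ is a $v\times v$ matrix $W=(w_{ij})$ with entries in $G\cup\{0\}$ such that (i) every row contains exactly $k$ nonzero entries, and (ii) for any distinct $i,h$, every element of $G$ occurs exactly $\lambda/|G|$ times in the multiset $\{w_{ij}w_{hj}^{-1}\mid 1\le j\le v,\ w_{ij}\ne0,\ w_{hj}\neq0\}$. It is symmetric if $w_{ij}=w_{ji}$ for all $i,j$. $U$ is the circulant $m\times m$ matrix with first row $(0,1,0,\dots,0)$ ($U=(1)$ if $m=1$), $C_m=\langle U\rangle$, so each nonzero $w_{ij}$ is a power of $U$. $R$ is the $m\times m$ back diagonal matrix (ones on the anti-diagonal). For $l\in\{0,\dots,m-1\}$, $N_l$ is the $(n+1)m\times(n+1)m$ matrix with $m\times m$ blocks $[N_l]_{ij}=J_m$ if $i=j$ and $[N_l]_{ij}=w_{ij}U^lR$ if $i\ne j$. $A_{l,0}=I_{n+1}\otimes U^l$, $A_{l,1}=N_l-I_{n+1}\otimes J_m$. $\chi_\beta$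 denotes the column vector $(\chi_\beta(\alpha))_{\alpha\in\mathbb{Z}_m}$, $\chi_\beta(\alpha)=w^{\alpha\beta}$, $w=e^{2\pi\sqrt{-1}/m}$; $\mathbf 0$ is the zero column vector of length $m$. *)

theory Defs
  imports
    Complex_Main
    "HOL-Library.FuncSet"
    "HOL-Combinatorics.Permutations"
    "HOL-Algebra.Group"
    "Jordan_Normal_Form.VS_Connect"
begin

definition mat_trace :: "complex mat \<Rightarrow> complex" where
  "mat_trace A = (\<Sum>i<dim_row A. A $$ (i, i))"

definition all_ones_mat :: "nat \<Rightarrow> complex mat" where
  "all_ones_mat r = mat r r (\<lambda>_. 1)"

definition adjacency_algebra :: "nat \<Rightarrow> complex mat list \<Rightarrow> complex mat set" where
  "adjacency_algebra N As =
     LinearCombinations.module.span class_ring (module_mat TYPE(complex) N N) (set As)"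

text \<open>Schemes are neither assumed to be symmetric nor to be commutative. The list
  \<open>As = [A\<^sub>0, \<dots>, A\<^sub>d]\<close> fixes the order of the columns of the character table.\<close>

definition association_scheme :: "nat \<Rightarrow> complex mat list \<Rightarrow> bool" where
  "association_scheme N As \<longleftrightarrow>
     As \<noteq> [] \<and>
     (\<forall>A\<in>set As. A \<in> carrier_mat N N \<and> elements_mat A \<subseteq> {0, 1} \<and> A \<noteq> 0\<^sub>m N N) \<and>
     As ! 0 = 1\<^sub>m N \<and>
     mat N N (\<lambda>(x, y). \<Sum>A\<leftarrow>As. A $$ (x, y)) = all_ones_mat N \<and>
     (\<forall>A\<in>set As. transpose_mat A \<in> set As) \<and>
     (\<forall>A\<in>set As. \<forall>B\<in>set As. A * B \<in> adjacency_algebra N As)"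

definition algebra_rep ::
    "nat \<Rightarrow> complex mat set \<Rightarrow> nat \<Rightarrow> (complex mat \<Rightarrow> complex mat) \<Rightarrow> bool" where
  "algebra_rep N \<A> r \<phi> \<longleftrightarrow>
     \<phi> \<in> \<A> \<rightarrow> carrier_mat r r \<and>
     \<phi> (1\<^sub>m N) = 1\<^sub>m r \<and>
     (\<forall>X\<in>\<A>. \<forall>Y\<in>\<A>. \<phi> (X + Y) = \<phi> X + \<phi> Y) \<and>
     (\<forall>c. \<forall>X\<in>\<A>. \<phi> (c \<cdot>\<^sub>m X) = c \<cdot>\<^sub>m \<phi> X) \<and>
     (\<forall>X\<in>\<A>. \<forall>Y\<in>\<A>. \<phi> (X * Y) = \<phi> X * \<phi> Y)"

text \<open>An algebra isomorphism from \<open>\<A>\<close> onto the direct sum of the full matrix algebras of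
  orders \<open>d 0, \<dots>, d (s - 1)\<close>, given by its components \<open>\<phi> 0, \<dots>, \<phi> (s - 1)\<close>. These components
  are irreducible (each maps onto a full matrix algebra) and pairwise inequivalent (their
  kernels differ), and they represent all irreducible representations of \<open>\<A>\<close>.\<close>

definition wedderburn_iso ::
    "nat \<Rightarrow> complex mat set \<Rightarrow> nat \<Rightarrow> (nat \<Rightarrow> nat) \<Rightarrow>
     (nat \<Rightarrow> complex mat \<Rightarrow> complex mat) \<Rightarrow> bool" where
  "wedderburn_iso N \<A> s d \<phi> \<longleftrightarrow>
     (\<forall>k<s. 0 < d k \<and> algebra_rep N \<A> (d k) (\<phi> k)) \<and>
     bij_betw (\<lambda>X. \<lambda>k\<in>{..<s}. \<phi> k X) \<A> (\<Pi>\<^sub>E k\<in>{..<s}. carrier_mat (d k) (d k))"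

text \<open>Character tables form a relation rather than a function, since the order of the
  irreducible representations is not determined.\<close>

definition is_character_table :: "nat \<Rightarrow> complex mat list \<Rightarrow> complex mat \<Rightarrow> bool" where
  "is_character_table N As T \<longleftrightarrow>
     (\<exists>s d \<phi>. wedderburn_iso N (adjacency_algebra N As) s d \<phi> \<and>
        T = mat s (length As) (\<lambda>(k, i). mat_trace (\<phi> k (As ! i))))"

definition eq_up_to_row_order :: "'a mat \<Rightarrow> 'a mat \<Rightarrow> bool" where
  "eq_up_to_row_order A B \<longleftrightarrow>
     (\<exists>p. p permutes {..<dim_row B} \<and>
        A = mat (dim_row B) (dim_col B) (\<lambda>(k, i). B $$ (p k, i)))"

text \<open>The element 0 adjoined to the group is \<open>None\<close>.\<close>

definition BGW :: "('a, 'b) monoid_scheme \<Rightarrow> nat \<Rightarrow> nat \<Rightarrow> nat \<Rightarrow> 'a option mat \<Rightarrow> bool" where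
  "BGW G v k lam W \<longleftrightarrow>
     group G \<and> finite (carrier G) \<and>
     W \<in> carrier_mat v v \<and>
     elements_mat W \<subseteq> insert None (Some ` carrier G) \<and>
     (\<forall>i<v. card {j. j < v \<and> W $$ (i, j) \<noteq> None} = k) \<and>
     (\<forall>i<v. \<forall>h<v. i \<noteq> h \<longrightarrow> (\<forall>g\<in>carrier G.
        real (card {j. j < v \<and> W $$ (i, j) \<noteq> None \<and> W $$ (h, j) \<noteq> None \<and>
                       the (W $$ (i, j)) \<otimes>\<^bsub>G\<^esub> inv\<^bsub>G\<^esub> (the (W $$ (h, j))) = g})
        = real lam / real (card (carrier G))))"

definition circ_U :: "nat \<Rightarrow> complex mat" where
  "circ_U m = mat m m (\<lambda>(i, j). if j = (i + 1) mod m then 1 else 0)"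

text \<open>As \<open>circ_U m\<close> has finite order, its natural powers form the group it generates.\<close>

definition cyclic_U :: "nat \<Rightarrow> complex mat monoid" where
  "cyclic_U m =
     \<lparr>carrier = range (\<lambda>l. circ_U m ^\<^sub>m l), mult = (\<lambda>A B. A * B), one = 1\<^sub>m m\<rparr>"

definition back_diag :: "nat \<Rightarrow> complex mat" where
  "back_diag m = mat m m (\<lambda>(i, j). if i + j = m - 1 then 1 else 0)"

definition kronecker :: "complex mat \<Rightarrow> complex mat \<Rightarrow> complex mat" where
  "kronecker A B =
     mat (dim_row A * dim_row B) (dim_col A * dim_col B)
       (\<lambda>(x, y). A $$ (x div dim_row B, y div dim_col B) * B $$ (x mod dim_row B, y mod dim_col B))"

definition block_mat :: "nat \<Rightarrow> nat \<Rightarrow> (nat \<Rightarrow> nat \<Rightarrow> complex mat) \<Rightarrow> complex mat" where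
  "block_mat v m B = mat (v * m) (v * m) (\<lambda>(x, y). B (x div m) (y div m) $$ (x mod m, y mod m))"

definition entry_mat :: "nat \<Rightarrow> complex mat option \<Rightarrow> complex mat" where
  "entry_mat m w = (case w of None \<Rightarrow> 0\<^sub>m m m | Some g \<Rightarrow> g)"

definition N_mat :: "nat \<Rightarrow> nat \<Rightarrow> complex mat option mat \<Rightarrow> nat \<Rightarrow> complex mat" where
  "N_mat n m W l =
     block_mat (n + 1) m
       (\<lambda>i j. if i = j then all_ones_mat m
              else entry_mat m (W $$ (i, j)) * circ_U m ^\<^sub>m l * back_diag m)"

definition A0_mat :: "nat \<Rightarrow> nat \<Rightarrow> nat \<Rightarrow> complex mat" where
  "A0_mat n m l = kronecker (1\<^sub>m (n + 1)) (circ_U m ^\<^sub>m l)"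

definition A1_mat :: "nat \<Rightarrow> nat \<Rightarrow> complex mat option mat \<Rightarrow> nat \<Rightarrow> complex mat" where
  "A1_mat n m W l = N_mat n m W l - kronecker (1\<^sub>m (n + 1)) (all_ones_mat m)"

definition BGW_scheme :: "nat \<Rightarrow> nat \<Rightarrow> complex mat option mat \<Rightarrow> complex mat list" where
  "BGW_scheme n m W = map (A0_mat n m) [0..<m] @ map (A1_mat n m W) [0..<m]"

definition chi :: "nat \<Rightarrow> nat \<Rightarrow> complex vec" where
  "chi m \<beta> = vec m (\<lambda>\<alpha>. exp (2 * of_real pi * \<i> / of_nat m) ^ (\<alpha> * \<beta>))"

definition table_even :: "nat \<Rightarrow> nat \<Rightarrow> complex mat" where
  "table_even n m = mat_of_rows (2 * m)
     ([chi m 0 @\<^sub>v of_nat n \<cdot>\<^sub>v chi m 0,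
       chi m 0 @\<^sub>v - chi m 0,
       chi m (m div 2) @\<^sub>v of_real (sqrt (real n)) \<cdot>\<^sub>v chi m (m div 2),
       chi m (m div 2) @\<^sub>v - of_real (sqrt (real n)) \<cdot>\<^sub>v chi m (m div 2)]
      @ map (\<lambda>\<beta>. (chi m \<beta> + chi m (m - \<beta>)) @\<^sub>v 0\<^sub>v m) [1..<m div 2])"

definition table_odd :: "nat \<Rightarrow> nat \<Rightarrow> complex mat" where
  "table_odd n m = mat_of_rows (2 * m)
     ([chi m 0 @\<^sub>v of_nat n \<cdot>\<^sub>v chi m 0,
       chi m 0 @\<^sub>v - chi m 0]
      @ map (\<lambda>\<beta>. (chi m \<beta> + chi m (m - \<beta>)) @\<^sub>v 0\<^sub>v m) [1..<(m - 1) div 2 + 1])"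

end

theory Submission
  imports Defs "HOL-Library.Real_Mod"
begin

text \<open>Let \<open>w\<close> be a primitive \<open>m\<close>-th root of unity. Conjugation by \<open>R\<close> inverts \<open>U\<close>, and the balance
  condition evaluates the products of the matrices \<open>A\<^bsub>l,1\<^esub>\<close>; so the algebra resembles that of a dihedral
  group: the \<open>A\<^bsub>l,0\<^esub>\<close> form a cyclic group of order \<open>m\<close>, every \<open>A\<^bsub>l,1\<^esub>\<close> is \<open>A\<^bsub>l,0\<^esub> A\<^bsub>0,1\<^esub>\<close>,
  conjugation by \<open>A\<^bsub>0,1\<^esub>\<close> inverts the cyclic group, and the square of \<open>A\<^bsub>0,1\<^esub>\<close> is
  \<open>n I + ((n - 1) / m) \<Sum>\<^sub>j A\<^bsub>j,1\<^esub>\<close>. Its representations are found as for a dihedral group. A frequency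
  \<open>\<beta>\<close> with \<open>\<beta> \<noteq> - \<beta>\<close> modulo \<open>m\<close> gives, together with \<open>- \<beta>\<close>, a two-dimensional representation in
  which the \<open>A\<^bsub>l,1\<^esub>\<close> have zero diagonal; the frequencies 0 and, for even \<open>m\<close>, \<open>m / 2\<close> give two
  one-dimensional representations each, for the two roots \<open>c\<close> of \<open>c\<^sup>2 = n + (n - 1) c\<close> and of
  \<open>c\<^sup>2 = n\<close>, respectively.

  Every element of the adjacency algebra is given by two coefficient functions on \<open>\<int>/m\<close>
  (\<open>adjacency_algebra_scheme_list\<close>), whose multiplication is a twisted convolution
  (\<open>scheme_mat_mult\<close>). The representations above are exactly the values of the Fourier transforms
  of these two functions, combined suitably. The transform is bijective; therefore the
  representations together form an isomorphism onto a direct sum of matrix algebras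
  (\<open>wedderburn_iso_irreps\<close>), and their traces are the rows of the table.

  It remains to see that every other isomorphism onto a direct sum of matrix algebras leads to the
  same table up to the order of its rows (\<open>character_table_unique\<close>). The units of the blocks, being
  the central primitive idempotents, give a bijection between the blocks of two decompositions. On
  matched blocks, the two characters are proportional because the trace is, up to a factor, the
  only functional that vanishes on commutators; the factor is 1 because it is the trace of a minimal
  idempotent (\<open>linked_traces_eq\<close>).\<close>

section \<open>Traces and matrix units\<close>

lemma mat_trace_add:
  assumes "A \<in> carrier_mat r r" "B \<in> carrier_mat r r"
  shows "mat_trace (A + B) = mat_trace A + mat_trace B"
  using assms by (auto simp: mat_trace_def sum.distrib)

lemma mat_trace_smult:
  assumes "A \<in> carrier_mat r r"
  shows "mat_trace (c \<cdot>\<^sub>m A) = c * mat_trace A"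
  using assms by (auto simp: mat_trace_def sum_distrib_left)

lemma index_mult_mat_sum:
  assumes "A \<in> carrier_mat r r" "B \<in> carrier_mat r r" "i < r" "j < r"
  shows "(A * B) $$ (i, j) = (\<Sum>k<r. A $$ (i, k) * B $$ (k, j))"
  using assms by (auto simp: scalar_prod_def atLeast0LessThan)

lemma mat_trace_mult_comm:
  assumes "A \<in> carrier_mat r r" "B \<in> carrier_mat r r"
  shows "mat_trace (A * B) = mat_trace (B * A)"
proof -
  have "mat_trace (A * B) = (\<Sum>i<r. \<Sum>k<r. A $$ (i, k) * B $$ (k, i))"
    using assms by (simp add: mat_trace_def index_mult_mat_sum del: index_mult_mat(1))
  also have "\<dots> = (\<Sum>k<r. \<Sum>i<r. B $$ (k, i) * A $$ (i, k))"
    by (subst sum.swap) (simp add: mult.commute)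
  also have "\<dots> = mat_trace (B * A)"
    using assms by (simp add: mat_trace_def index_mult_mat_sum del: index_mult_mat(1))
  finally show ?thesis .
qed

definition matrix_unit :: "nat \<Rightarrow> nat \<Rightarrow> nat \<Rightarrow> complex mat" where
  "matrix_unit r i j = mat r r (\<lambda>(x, y). if x = i \<and> y = j then 1 else 0)"

lemma matrix_unit_carrier [simp]: "matrix_unit r i j \<in> carrier_mat r r"
  by (simp add: matrix_unit_def)

lemma mult_matrix_unit_index:
  assumes "A \<in> carrier_mat r r" "i < r" "j < r" "x < r" "y < r"
  shows "(A * matrix_unit r i j) $$ (x, y) = (if y = j then A $$ (x, i) else 0)"
    and "(matrix_unit r i j * A) $$ (x, y) = (if x = i then A $$ (j, y) else 0)"
proof -
  have "(\<Sum>k<r. A $$ (x, k) * matrix_unit r i j $$ (k, y)) =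
    (\<Sum>k<r. if k = i then (if y = j then A $$ (x, i) else 0) else 0)"
    using assms by (intro sum.cong) (auto simp: matrix_unit_def)
  then show "(A * matrix_unit r i j) $$ (x, y) = (if y = j then A $$ (x, i) else 0)"
    using assms by (simp add: index_mult_mat_sum[of _ r] del: index_mult_mat(1))
  have "(\<Sum>k<r. matrix_unit r i j $$ (x, k) * A $$ (k, y)) =
    (\<Sum>k<r. if k = j then (if x = i then A $$ (j, y) else 0) else 0)"
    using assms by (intro sum.cong) (auto simp: matrix_unit_def)
  then show "(matrix_unit r i j * A) $$ (x, y) = (if x = i then A $$ (j, y) else 0)"
    using assms by (simp add: index_mult_mat_sum[of _ r] del: index_mult_mat(1))
qed

lemma matrix_unit_mult:
  assumes "i < r" "j < r" "k < r" "l < r"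
  shows "matrix_unit r i j * matrix_unit r k l = (if j = k then matrix_unit r i l else 0\<^sub>m r r)"
proof (rule eq_matI)
  fix x y
  assume "x < dim_row (if j = k then matrix_unit r i l else 0\<^sub>m r r)"
    "y < dim_col (if j = k then matrix_unit r i l else 0\<^sub>m r r)"
  then have xy: "x < r" "y < r" by (auto simp: matrix_unit_def split: if_splits)
  show "(matrix_unit r i j * matrix_unit r k l) $$ (x, y) =
    (if j = k then matrix_unit r i l else 0\<^sub>m r r) $$ (x, y)"
    using xy assms
    by (subst mult_matrix_unit_index(1)[where r = r]) (auto simp: matrix_unit_def)
qed (auto simp: matrix_unit_def)

text \<open>This is what makes \<open>E\<^sub>0\<^sub>0\<close> a minimal idempotent, a notion that refers to the algebra structure only
  and is therefore preserved by isomorphisms.\<close>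

lemma corner_matrix_unit:
  assumes "M \<in> carrier_mat r r" "0 < r"
  shows "matrix_unit r 0 0 * M * matrix_unit r 0 0 = M $$ (0, 0) \<cdot>\<^sub>m matrix_unit r 0 0"
proof (rule eq_matI)
  fix x y
  assume "x < dim_row (M $$ (0, 0) \<cdot>\<^sub>m matrix_unit r 0 0)"
    "y < dim_col (M $$ (0, 0) \<cdot>\<^sub>m matrix_unit r 0 0)"
  then have xy: "x < r" "y < r" by (auto simp: matrix_unit_def)
  have "matrix_unit r 0 0 * M \<in> carrier_mat r r" using assms(1) by (intro mult_carrier_mat) auto
  then show "(matrix_unit r 0 0 * M * matrix_unit r 0 0) $$ (x, y) =
    (M $$ (0, 0) \<cdot>\<^sub>m matrix_unit r 0 0) $$ (x, y)"
    using xy assms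
    by (simp add: mult_matrix_unit_index[where r = r] del: index_mult_mat(1))
       (auto simp: matrix_unit_def)
qed (use assms in \<open>auto simp: matrix_unit_def\<close>)

text \<open>A functional that vanishes on commutators kills \<open>E\<^sub>i\<^sub>j = E\<^sub>i\<^sub>i E\<^sub>i\<^sub>j - E\<^sub>i\<^sub>j E\<^sub>i\<^sub>i\<close> for
  \<open>i \<noteq> j\<close> and takes the same value on all \<open>E\<^sub>i\<^sub>i\<close>, since
  \<open>E\<^sub>i\<^sub>i - E\<^sub>0\<^sub>0 = E\<^sub>i\<^sub>0 E\<^sub>0\<^sub>i - E\<^sub>0\<^sub>i E\<^sub>i\<^sub>0\<close>.\<close>

lemma trace_functional_unique:
  fixes f :: "complex mat \<Rightarrow> complex"
  assumes add: "\<And>M K. M \<in> carrier_mat r r \<Longrightarrow> K \<in> carrier_mat r r \<Longrightarrow> f (M + K) = f M + f K"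
    and smult: "\<And>c M. M \<in> carrier_mat r r \<Longrightarrow> f (c \<cdot>\<^sub>m M) = c * f M"
    and comm: "\<And>M K. M \<in> carrier_mat r r \<Longrightarrow> K \<in> carrier_mat r r \<Longrightarrow> f (M * K) = f (K * M)"
    and M: "M \<in> carrier_mat r r"
  shows "f M = f (matrix_unit r 0 0) * mat_trace M"
proof -
  have f0: "f (0\<^sub>m r r) = 0"
    using smult[of "0\<^sub>m r r" 0] by simp
  have off: "f (matrix_unit r i j) = 0" if "i < r" "j < r" "i \<noteq> j" for i j
    using comm[of "matrix_unit r i i" "matrix_unit r i j"] that f0 by (simp add: matrix_unit_mult)
  have diag: "f (matrix_unit r i i) = f (matrix_unit r 0 0)" if "i < r" for i
    using comm[of "matrix_unit r i 0" "matrix_unit r 0 i"] that by (simp add: matrix_unit_mult)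
  define restr where "restr S = mat r r (\<lambda>p. if p \<in> S then M $$ p else 0)" for S
  have expand: "f (restr S) = (\<Sum>p\<in>S. M $$ p * f (matrix_unit r (fst p) (snd p)))"
    if "finite S" "S \<subseteq> {..<r} \<times> {..<r}" for S
    using that
  proof (induction S rule: finite_induct)
    case empty
    have "restr {} = 0\<^sub>m r r" by (auto simp: restr_def)
    then show ?case by (simp add: f0)
  next
    case (insert p S)
    have "restr (insert p S) = M $$ p \<cdot>\<^sub>m matrix_unit r (fst p) (snd p) + restr S"
      using insert.hyps insert.prems by (auto simp: restr_def matrix_unit_def)
    moreover have "restr S \<in> carrier_mat r r" by (simp add: restr_def)
    ultimately show ?case using insert by (simp add: add smult)
  qed
  have "restr ({..<r} \<times> {..<r}) = M" using M by (auto simp: restr_def)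
  then have "f M = (\<Sum>p\<in>{..<r} \<times> {..<r}. M $$ p * f (matrix_unit r (fst p) (snd p)))"
    using expand[of "{..<r} \<times> {..<r}"] by simp
  also have "\<dots> = (\<Sum>i<r. \<Sum>j<r. M $$ (i, j) * f (matrix_unit r i j))"
    by (simp add: sum.cartesian_product split_def)
  also have "\<dots> = (\<Sum>i<r. \<Sum>j<r. if j = i then M $$ (i, i) * f (matrix_unit r 0 0) else 0)"
  proof (intro sum.cong refl)
    fix i j assume "i \<in> {..<r}" "j \<in> {..<r}"
    then show "M $$ (i, j) * f (matrix_unit r i j) =
      (if j = i then M $$ (i, i) * f (matrix_unit r 0 0) else 0)"
      using off[of i j] diag[of i] by auto
  qed
  also have "\<dots> = f (matrix_unit r 0 0) * mat_trace M"
    using M by (simp add: mat_trace_def sum_distrib_left mult.commute)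
  finally show ?thesis .
qed

text \<open>Let \<open>t\<close> be the trace of \<open>F\<close>. Comparing entries in \<open>F E\<^sub>i\<^sub>j F = c F\<close> shows that \<open>F\<close> has rank at
  most one, in the form \<open>F\<^sub>x\<^sub>i F\<^sub>j\<^sub>y t = F\<^sub>j\<^sub>i F\<^sub>x\<^sub>y\<close>. For \<open>x = i\<close> and \<open>y = j\<close>, summation over \<open>i\<close> and \<open>j\<close> turns
  the left-hand side into \<open>t\<^sup>3\<close> and the right-hand side into the trace of \<open>F\<^sup>2 = F\<close>.\<close>

lemma minimal_idempotent_trace:
  assumes F: "F \<in> carrier_mat r r" "F * F = F"
    and corner: "\<And>Y. Y \<in> carrier_mat r r \<Longrightarrow> \<exists>c. F * Y * F = c \<cdot>\<^sub>m F"
  shows "mat_trace F ^ 3 = mat_trace F"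
proof -
  define t where "t = mat_trace F"
  have t: "t = (\<Sum>i<r. F $$ (i, i))" using F by (simp add: t_def mat_trace_def)
  have idem: "(\<Sum>k<r. F $$ (i, k) * F $$ (k, j)) = F $$ (i, j)" if "i < r" "j < r" for i j
    using index_mult_mat_sum[OF F(1) F(1) that] F(2) by simp
  have rank_one: "F $$ (x, i) * F $$ (j, y) * t = F $$ (j, i) * F $$ (x, y)"
    if "x < r" "i < r" "j < r" "y < r" for x y i j
  proof -
    obtain c where c: "F * matrix_unit r i j * F = c \<cdot>\<^sub>m F"
      using corner[of "matrix_unit r i j"] by auto
    have G: "F * matrix_unit r i j \<in> carrier_mat r r" using F(1) by (intro mult_carrier_mat) auto
    have entry: "F $$ (u, i) * F $$ (j, v) = c * F $$ (u, v)" if uv: "u < r" "v < r" for u v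
    proof -
      have "c * F $$ (u, v) = (\<Sum>k<r. (F * matrix_unit r i j) $$ (u, k) * F $$ (k, v))"
        using index_mult_mat_sum[OF G F(1) uv] c uv F(1) by simp
      also have "\<dots> = (\<Sum>k<r. if k = j then F $$ (u, i) * F $$ (j, v) else 0)"
        using uv \<open>i < r\<close> \<open>j < r\<close> F(1)
        by (intro sum.cong) (auto simp: mult_matrix_unit_index[where r = r] simp del: index_mult_mat(1))
      finally show ?thesis using \<open>j < r\<close> by simp
    qed
    have "c * t = (\<Sum>u<r. F $$ (j, u) * F $$ (u, i))"
      unfolding t sum_distrib_left
    proof (intro sum.cong refl)
      fix u assume "u \<in> {..<r}"
      then show "c * F $$ (u, u) = F $$ (j, u) * F $$ (u, i)"
        using entry[of u u] by (simp add: mult.commute)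
    qed
    then have "c * t = F $$ (j, i)" using idem[of j i] that by simp
    then show ?thesis using entry[of x y] that by (metis mult.assoc mult.commute)
  qed
  have "t ^ 3 = (\<Sum>i<r. F $$ (i, i)) * (\<Sum>j<r. F $$ (j, j)) * t"
    by (simp add: power3_eq_cube flip: t)
  also have "\<dots> = (\<Sum>i<r. \<Sum>j<r. F $$ (i, i) * F $$ (j, j) * t)"
    by (subst sum_product) (simp add: sum_distrib_right)
  also have "\<dots> = (\<Sum>i<r. \<Sum>j<r. F $$ (i, j) * F $$ (j, i))"
  proof (intro sum.cong refl)
    fix i j assume "i \<in> {..<r}" "j \<in> {..<r}"
    then show "F $$ (i, i) * F $$ (j, j) * t = F $$ (i, j) * F $$ (j, i)"
      using rank_one[of i i j j] by (simp add: mult.commute)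
  qed
  also have "\<dots> = t" using idem by (simp add: t)
  finally show ?thesis by (simp add: t_def)
qed

text \<open>Commuting with the matrix units \<open>E\<^sub>i\<^sub>0\<close> makes \<open>M\<close> a scalar matrix, and an idempotent scalar is
  0 or 1.\<close>

lemma central_idempotent_0_or_1:
  fixes M :: "complex mat"
  assumes M: "M \<in> carrier_mat r r" "M * M = M" "0 < r"
    and central: "\<And>Y. Y \<in> carrier_mat r r \<Longrightarrow> M * Y = Y * M"
  shows "M = 0\<^sub>m r r \<or> M = 1\<^sub>m r"
proof -
  have entry: "M $$ (x, i) = (if x = i then M $$ (0, 0) else 0)" if "x < r" "i < r" for x i
    using mult_matrix_unit_index[OF M(1) that(2) M(3) that(1) M(3)] central[of "matrix_unit r i 0"]
    by simp
  have M': "M = M $$ (0, 0) \<cdot>\<^sub>m 1\<^sub>m r"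
  proof (rule eq_matI)
    fix x i
    assume "x < dim_row (M $$ (0, 0) \<cdot>\<^sub>m 1\<^sub>m r)" "i < dim_col (M $$ (0, 0) \<cdot>\<^sub>m 1\<^sub>m r)"
    then show "M $$ (x, i) = (M $$ (0, 0) \<cdot>\<^sub>m 1\<^sub>m r) $$ (x, i)"
      using entry[of x i] by simp
  qed (use M in auto)
  have "M $$ (0, 0) = (\<Sum>k<r. M $$ (0, k) * M $$ (k, 0))"
    using index_mult_mat_sum[OF M(1) M(1) M(3) M(3)] M(2) by simp
  also have "\<dots> = (\<Sum>k<r. if k = 0 then M $$ (0, 0) * M $$ (0, 0) else 0)"
  proof (intro sum.cong refl)
    fix k assume "k \<in> {..<r}"
    then show "M $$ (0, k) * M $$ (k, 0) = (if k = 0 then M $$ (0, 0) * M $$ (0, 0) else 0)"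
      using entry[of 0 k] M(3) by auto
  qed
  finally have "M $$ (0, 0) = M $$ (0, 0) * M $$ (0, 0)" using M(3) by simp
  then have "M $$ (0, 0) = 0 \<or> M $$ (0, 0) = 1" by simp
  then show ?thesis using M' M(1) by fastforce
qed

section \<open>Uniqueness of character tables\<close>

definition matrix_algebra :: "nat \<Rightarrow> complex mat set \<Rightarrow> bool" where
  "matrix_algebra N \<A> \<longleftrightarrow> \<A> \<subseteq> carrier_mat N N \<and> 1\<^sub>m N \<in> \<A> \<and>
     (\<forall>X\<in>\<A>. \<forall>Y\<in>\<A>. X + Y \<in> \<A> \<and> X * Y \<in> \<A>) \<and> (\<forall>c. \<forall>X\<in>\<A>. c \<cdot>\<^sub>m X \<in> \<A>)"

locale wedderburn =
  fixes N :: nat and \<A> :: "complex mat set" and s :: nat and d :: "nat \<Rightarrow> nat"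
    and \<phi> :: "nat \<Rightarrow> complex mat \<Rightarrow> complex mat"
  assumes alg: "matrix_algebra N \<A>" and iso: "wedderburn_iso N \<A> s d \<phi>"
begin

lemma closed:
  shows "1\<^sub>m N \<in> \<A>" "X \<in> \<A> \<Longrightarrow> X \<in> carrier_mat N N"
    and "X \<in> \<A> \<Longrightarrow> Y \<in> \<A> \<Longrightarrow> X + Y \<in> \<A>" "X \<in> \<A> \<Longrightarrow> Y \<in> \<A> \<Longrightarrow> X * Y \<in> \<A>"
    and "X \<in> \<A> \<Longrightarrow> c \<cdot>\<^sub>m X \<in> \<A>"
  using alg by (auto simp: matrix_algebra_def)

lemma rep:
  assumes "k < s"
  shows "0 < d k" "X \<in> \<A> \<Longrightarrow> \<phi> k X \<in> carrier_mat (d k) (d k)" "\<phi> k (1\<^sub>m N) = 1\<^sub>m (d k)"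
    and "X \<in> \<A> \<Longrightarrow> Y \<in> \<A> \<Longrightarrow> \<phi> k (X + Y) = \<phi> k X + \<phi> k Y"
    and "X \<in> \<A> \<Longrightarrow> Y \<in> \<A> \<Longrightarrow> \<phi> k (X * Y) = \<phi> k X * \<phi> k Y"
    and "X \<in> \<A> \<Longrightarrow> \<phi> k (c \<cdot>\<^sub>m X) = c \<cdot>\<^sub>m \<phi> k X"
  using iso assms by (auto simp: wedderburn_iso_def algebra_rep_def)

lemma eq_if_all_reps_eq:
  assumes "X \<in> \<A>" "Y \<in> \<A>" "\<And>k. k < s \<Longrightarrow> \<phi> k X = \<phi> k Y"
  shows "X = Y"
proof -
  have "inj_on (\<lambda>X. \<lambda>k\<in>{..<s}. \<phi> k X) \<A>"
    using iso by (simp add: wedderburn_iso_def bij_betw_def)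
  moreover have "(\<lambda>k\<in>{..<s}. \<phi> k X) = (\<lambda>k\<in>{..<s}. \<phi> k Y)"
    using assms(3) by (auto simp: restrict_def)
  ultimately show ?thesis using assms(1,2) by (auto dest: inj_onD)
qed

text \<open>The inverse of the isomorphism on the \<open>k\<close>-th block. The preimage is unique, so the choice is
  immaterial.\<close>

definition embed :: "nat \<Rightarrow> complex mat \<Rightarrow> complex mat" where
  "embed k M = (SOME X. X \<in> \<A> \<and> (\<forall>j<s. \<phi> j X = (if j = k then M else 0\<^sub>m (d j) (d j))))"

lemma embed:
  assumes "k < s" "M \<in> carrier_mat (d k) (d k)"
  shows embed_closed: "embed k M \<in> \<A>"
    and rep_embed: "j < s \<Longrightarrow> \<phi> j (embed k M) = (if j = k then M else 0\<^sub>m (d j) (d j))"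
proof -
  have "(\<lambda>j\<in>{..<s}. if j = k then M else 0\<^sub>m (d j) (d j)) \<in> (\<Pi>\<^sub>E j\<in>{..<s}. carrier_mat (d j) (d j))"
    using assms by auto
  then have "(\<lambda>j\<in>{..<s}. if j = k then M else 0\<^sub>m (d j) (d j)) \<in> (\<lambda>X. \<lambda>j\<in>{..<s}. \<phi> j X) ` \<A>"
    using iso by (simp add: wedderburn_iso_def bij_betw_def)
  then obtain X where X: "X \<in> \<A>"
    and eq: "(\<lambda>j\<in>{..<s}. if j = k then M else 0\<^sub>m (d j) (d j)) = (\<lambda>j\<in>{..<s}. \<phi> j X)"
    by (rule imageE)
  have "\<phi> j X = (if j = k then M else 0\<^sub>m (d j) (d j))" if "j < s" for j
    using fun_cong[OF eq, of j] that by simp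
  with X have "\<exists>X. X \<in> \<A> \<and> (\<forall>j<s. \<phi> j X = (if j = k then M else 0\<^sub>m (d j) (d j)))"
    by blast
  from someI_ex[OF this] show "embed k M \<in> \<A>"
    "j < s \<Longrightarrow> \<phi> j (embed k M) = (if j = k then M else 0\<^sub>m (d j) (d j))"
    by (simp_all add: embed_def)
qed

lemma embed_hom:
  assumes "k < s" "M \<in> carrier_mat (d k) (d k)" "K \<in> carrier_mat (d k) (d k)"
  shows "embed k (M + K) = embed k M + embed k K"
    and "embed k (c \<cdot>\<^sub>m M) = c \<cdot>\<^sub>m embed k M"
    and "embed k (M * K) = embed k M * embed k K"
  by (rule eq_if_all_reps_eq; use assms in \<open>simp add: closed embed_closed rep_embed rep\<close>)+

text \<open>The central primitive idempotents of the algebra. They are what identifies a block without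
  reference to the chosen isomorphism.\<close>

definition block_unit :: "nat \<Rightarrow> complex mat" where
  "block_unit k = embed k (1\<^sub>m (d k))"

lemma block_unit_closed: "k < s \<Longrightarrow> block_unit k \<in> \<A>"
  by (simp add: block_unit_def embed_closed)

lemma rep_block_unit:
  "k < s \<Longrightarrow> j < s \<Longrightarrow> \<phi> j (block_unit k) = (if j = k then 1\<^sub>m (d k) else 0\<^sub>m (d j) (d j))"
  by (simp add: block_unit_def rep_embed)

lemma mult_block_unit:
  assumes "k < s" "X \<in> \<A>"
  shows "X * block_unit k = embed k (\<phi> k X)" "block_unit k * X = embed k (\<phi> k X)"
  by (rule eq_if_all_reps_eq;
      use assms in \<open>auto simp: closed embed_closed rep_embed rep block_unit_closed rep_block_unit
        left_mult_zero_mat[OF rep(2)] right_mult_zero_mat[OF rep(2)] left_mult_one_mat[OF rep(2)]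
        right_mult_one_mat[OF rep(2)]\<close>)+

lemma zero_closed: "0\<^sub>m N N \<in> \<A>"
proof -
  have "(0 :: complex) \<cdot>\<^sub>m 1\<^sub>m N = 0\<^sub>m N N" by auto
  then show ?thesis using closed(5)[OF closed(1), of 0] by simp
qed

lemma rep_zero: "k < s \<Longrightarrow> \<phi> k (0\<^sub>m N N) = 0\<^sub>m (d k) (d k)"
proof -
  assume k: "k < s"
  have "(0 :: complex) \<cdot>\<^sub>m 0\<^sub>m N N = 0\<^sub>m N N" by auto
  then have "\<phi> k (0\<^sub>m N N) = 0 \<cdot>\<^sub>m \<phi> k (0\<^sub>m N N)"
    using rep(6)[OF k zero_closed, of 0] by simp
  also have "\<dots> = 0\<^sub>m (d k) (d k)"
    using rep(2)[OF k zero_closed] by auto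
  finally show ?thesis .
qed

lemma embed_zero: "k < s \<Longrightarrow> embed k (0\<^sub>m (d k) (d k)) = 0\<^sub>m N N"
  by (rule eq_if_all_reps_eq) (simp_all add: embed_closed zero_closed rep_embed rep_zero)

lemma one_neq_zero: "k < s \<Longrightarrow> 1\<^sub>m (d k) \<noteq> (0\<^sub>m (d k) (d k) :: complex mat)"
  using rep(1)[of k] by (metis index_one_mat(1) index_zero_mat(1) zero_neq_one)

lemma block_unit_orthogonal:
  assumes "k < s" "j < s" "j \<noteq> k"
  shows "block_unit k * block_unit j = 0\<^sub>m N N"
  using assms by (simp add: mult_block_unit(1) rep_block_unit block_unit_closed embed_zero)

end

text \<open>Two decompositions of the same algebra. A block of the first is matched with the block of the
  second in which its unit acts as the identity.\<close>

locale two_wedderburn =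
  W1: wedderburn N \<A> s d \<phi> + W2: wedderburn N \<A> s' d' \<phi>' for N \<A> s d \<phi> s' d' \<phi>'
begin

text \<open>The block unit is central in the algebra and \<open>\<phi>' k'\<close> is onto, so its image is a central
  idempotent of a full matrix algebra.\<close>

lemma block_unit_image:
  assumes "k < s" "k' < s'"
  shows "\<phi>' k' (W1.block_unit k) = 0\<^sub>m (d' k') (d' k') \<or> \<phi>' k' (W1.block_unit k) = 1\<^sub>m (d' k')"
proof (rule central_idempotent_0_or_1)
  have e: "W1.block_unit k \<in> \<A>" using assms by (simp add: W1.block_unit_closed)
  show "\<phi>' k' (W1.block_unit k) \<in> carrier_mat (d' k') (d' k')" "0 < d' k'"
    using assms e by (simp_all add: W2.rep)
  have "W1.block_unit k * W1.block_unit k = W1.block_unit k"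
    using assms e by (simp add: W1.mult_block_unit(1) W1.rep_block_unit)
      (simp add: W1.block_unit_def)
  then show "\<phi>' k' (W1.block_unit k) * \<phi>' k' (W1.block_unit k) = \<phi>' k' (W1.block_unit k)"
    using assms e by (metis W2.rep(5))
  fix Y :: "complex mat"
  assume Y: "Y \<in> carrier_mat (d' k') (d' k')"
  then have X: "W2.embed k' Y \<in> \<A>" "\<phi>' k' (W2.embed k' Y) = Y"
    using assms by (simp_all add: W2.embed_closed W2.rep_embed)
  have "W1.block_unit k * W2.embed k' Y = W2.embed k' Y * W1.block_unit k"
    using assms X by (simp add: W1.mult_block_unit)
  then show "\<phi>' k' (W1.block_unit k) * Y = Y * \<phi>' k' (W1.block_unit k)"
    using assms e X by (metis W2.rep(5))
qed

definition linked :: "nat \<Rightarrow> nat \<Rightarrow> bool" where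
  "linked k k' \<longleftrightarrow> \<phi>' k' (W1.block_unit k) = 1\<^sub>m (d' k')"

text \<open>This makes the matching symmetric in the two decompositions. If \<open>k\<close> and \<open>k'\<close> were not linked,
  the product of the two block units, read in the block \<open>k'\<close>, would vanish; read in the block
  \<open>k\<close>, it is the block unit of \<open>k\<close>.\<close>

lemma linked_if_rep_block_unit:
  assumes "k < s" "k' < s'" "\<phi> k (W2.block_unit k') = 1\<^sub>m (d k)"
  shows "linked k k'"
proof (rule ccontr)
  assume "\<not> linked k k'"
  then have "\<phi>' k' (W1.block_unit k) = 0\<^sub>m (d' k') (d' k')"
    using block_unit_image[OF assms(1,2)] by (simp add: linked_def)
  then have "W1.block_unit k * W2.block_unit k' = 0\<^sub>m N N"
    using assms by (simp add: W2.mult_block_unit(1) W1.block_unit_closed W2.embed_zero)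
  moreover have "W1.block_unit k * W2.block_unit k' = W1.block_unit k"
    using assms by (simp add: W1.mult_block_unit(2) W2.block_unit_closed)
      (simp add: W1.block_unit_def)
  ultimately have "\<phi> k (W1.block_unit k) = 0\<^sub>m (d k) (d k)"
    using assms W1.rep_zero by simp
  then show False using assms W1.one_neq_zero by (simp add: W1.rep_block_unit)
qed

text \<open>Otherwise the block unit of \<open>k\<close> would be killed by all representations of the second
  decomposition and hence be zero.\<close>

lemma linked_exists:
  assumes "k < s"
  shows "\<exists>k'<s'. linked k k'"
proof (rule ccontr)
  assume "\<not> (\<exists>k'<s'. linked k k')"
  then have "\<phi>' k' (W1.block_unit k) = \<phi>' k' (0\<^sub>m N N)" if "k' < s'" for k'
    using block_unit_image[OF assms that] that by (auto simp: linked_def W2.rep_zero)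
  then have "W1.block_unit k = 0\<^sub>m N N"
    using W2.eq_if_all_reps_eq[OF W1.block_unit_closed W1.zero_closed] assms by blast
  then have "1\<^sub>m (d k) = (0\<^sub>m (d k) (d k) :: complex mat)"
    using W1.rep_block_unit[of k k] W1.rep_zero[of k] assms by simp
  then show False using W1.one_neq_zero assms by blast
qed

text \<open>Distinct block units are orthogonal, so they cannot both act as the identity.\<close>

lemma linked_left_unique:
  assumes "k < s" "j < s" "k' < s'" "linked k k'" "linked j k'"
  shows "k = j"
proof (rule ccontr)
  assume "k \<noteq> j"
  then have "W1.block_unit k * W1.block_unit j = 0\<^sub>m N N"
    using assms by (simp add: W1.block_unit_orthogonal)
  then have "\<phi>' k' (W1.block_unit k) * \<phi>' k' (W1.block_unit j) = 0\<^sub>m (d' k') (d' k')"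
    using assms W2.rep(5)[of k' "W1.block_unit k" "W1.block_unit j"]
    by (simp add: W1.block_unit_closed W2.rep_zero)
  then show False using assms W2.one_neq_zero by (simp add: linked_def)
qed

text \<open>For linked blocks, \<open>\<phi>' k'\<close> factors through \<open>\<phi> k\<close> by a unital algebra homomorphism \<open>\<psi>\<close>. The
  functional \<open>tr \<circ> \<psi>\<close> vanishes on commutators, hence is \<open>c tr\<close> with
  \<open>c = tr (\<psi> E\<^sub>0\<^sub>0)\<close>; evaluation at the identity gives \<open>d' k' = c d k\<close>, so that \<open>c > 0\<close>. As \<open>\<psi> E\<^sub>0\<^sub>0\<close>
  is an idempotent that compresses every matrix to a multiple of itself, \<open>c\<^sup>3 = c\<close>. Hence
  \<open>c = 1\<close>. This replaces both the Skolem--Noether theorem and a dimension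
  count.\<close>

lemma linked_traces_eq:
  assumes k: "k < s" and k': "k' < s'" and linked: "linked k k'" and X: "X \<in> \<A>"
  shows "mat_trace (\<phi>' k' X) = mat_trace (\<phi> k X)"
proof -
  define \<psi> where "\<psi> M = \<phi>' k' (W1.embed k M)" for M
  have \<psi>_carrier: "\<psi> M \<in> carrier_mat (d' k') (d' k')" if "M \<in> carrier_mat (d k) (d k)" for M
    using k k' that by (simp add: \<psi>_def W2.rep W1.embed_closed)
  have \<psi>_mult: "\<psi> (M * K) = \<psi> M * \<psi> K"
    if "M \<in> carrier_mat (d k) (d k)" "K \<in> carrier_mat (d k) (d k)" for M K
    using k k' that by (simp add: \<psi>_def W1.embed_hom W2.rep W1.embed_closed)
  have \<psi>_smult: "\<psi> (c \<cdot>\<^sub>m M) = c \<cdot>\<^sub>m \<psi> M" if "M \<in> carrier_mat (d k) (d k)" for c M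
    using k k' that by (simp add: \<psi>_def W1.embed_hom(2)[OF k that that] W2.rep W1.embed_closed)
  have factor: "\<phi>' k' Y = \<psi> (\<phi> k Y)" if "Y \<in> \<A>" for Y
  proof -
    have "\<phi>' k' Y = \<phi>' k' Y * \<phi>' k' (W1.block_unit k)"
      using linked k' that by (simp add: linked_def right_mult_one_mat[OF W2.rep(2)])
    also have "\<dots> = \<phi>' k' (Y * W1.block_unit k)"
      using k k' that by (simp add: W2.rep W1.block_unit_closed)
    finally show ?thesis using k that by (simp add: \<psi>_def W1.mult_block_unit)
  qed
  define F where "F = \<psi> (matrix_unit (d k) 0 0)"
  have d_pos: "0 < d k" "0 < d' k'" using k k' by (simp_all add: W1.rep W2.rep)
  have F: "F \<in> carrier_mat (d' k') (d' k')" by (simp add: F_def \<psi>_carrier)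
  have trace: "mat_trace (\<psi> M) = mat_trace F * mat_trace M" if "M \<in> carrier_mat (d k) (d k)" for M
    unfolding F_def
  proof (rule trace_functional_unique[OF _ _ _ that])
    fix M K :: "complex mat"
    assume MK: "M \<in> carrier_mat (d k) (d k)" "K \<in> carrier_mat (d k) (d k)"
    have "\<psi> (M + K) = \<psi> M + \<psi> K"
      using k k' MK by (simp add: \<psi>_def W1.embed_hom W2.rep W1.embed_closed)
    then show "mat_trace (\<psi> (M + K)) = mat_trace (\<psi> M) + mat_trace (\<psi> K)"
      using MK by (simp add: mat_trace_add[OF \<psi>_carrier \<psi>_carrier])
    show "mat_trace (\<psi> (M * K)) = mat_trace (\<psi> (K * M))"
      using MK mat_trace_mult_comm[OF \<psi>_carrier \<psi>_carrier] by (simp add: \<psi>_mult)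
  next
    fix c and M :: "complex mat"
    assume "M \<in> carrier_mat (d k) (d k)"
    then show "mat_trace (\<psi> (c \<cdot>\<^sub>m M)) = c * mat_trace (\<psi> M)"
      by (simp add: \<psi>_smult mat_trace_smult[OF \<psi>_carrier])
  qed
  have "\<psi> (1\<^sub>m (d k)) = 1\<^sub>m (d' k')"
    using factor[OF W1.closed(1)] k k' by (simp add: W1.rep W2.rep)
  then have dims: "of_nat (d' k') = mat_trace F * of_nat (d k)"
    using trace[of "1\<^sub>m (d k)"] by (simp add: mat_trace_def)
  have "mat_trace F ^ 3 = mat_trace F"
  proof (rule minimal_idempotent_trace[OF F])
    show "F * F = F"
      using d_pos unfolding F_def by (simp flip: \<psi>_mult add: matrix_unit_mult)
    fix Y :: "complex mat"
    assume Y: "Y \<in> carrier_mat (d' k') (d' k')"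
    define M where "M = \<phi> k (W2.embed k' Y)"
    have M: "M \<in> carrier_mat (d k) (d k)"
      using k k' Y by (simp add: M_def W1.rep W2.embed_closed)
    have "Y = \<psi> M"
      using factor[of "W2.embed k' Y"] k' Y by (simp add: M_def W2.embed_closed W2.rep_embed)
    moreover have "matrix_unit (d k) 0 0 * M \<in> carrier_mat (d k) (d k)"
      using M by (intro mult_carrier_mat) auto
    ultimately have "F * Y * F = \<psi> (M $$ (0, 0) \<cdot>\<^sub>m matrix_unit (d k) 0 0)"
      using M d_pos by (simp add: F_def flip: \<psi>_mult corner_matrix_unit)
    then show "\<exists>c. F * Y * F = c \<cdot>\<^sub>m F" by (auto simp: F_def \<psi>_smult)
  qed
  then have "mat_trace F = 0 \<or> mat_trace F = 1 \<or> mat_trace F = - 1"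
    by (auto simp: power3_eq_cube square_eq_1_iff)
  moreover have "mat_trace F \<noteq> 0" using dims d_pos by auto
  moreover have "mat_trace F \<noteq> - 1"
  proof
    assume "mat_trace F = - 1"
    then have "(of_nat (d' k' + d k) :: complex) = 0" using dims by simp
    then show False using d_pos unfolding of_nat_eq_0_iff by simp
  qed
  ultimately show ?thesis
    using trace[of "\<phi> k X"] factor[OF X] k X by (simp add: W1.rep)
qed

end

text \<open>The linked pairs form the graph of a bijection between the blocks of the two decompositions,
  and linked blocks have the same character.\<close>

theorem character_table_unique:
  assumes alg: "matrix_algebra N (adjacency_algebra N As)" and As: "set As \<subseteq> adjacency_algebra N As"
    and T: "is_character_table N As T" and T': "is_character_table N As T'"
  shows "eq_up_to_row_order T T'"
proof -
  let ?A = "adjacency_algebra N As"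
  obtain s d \<phi> where W1: "wedderburn_iso N ?A s d \<phi>"
    and T_eq: "T = mat s (length As) (\<lambda>(k, i). mat_trace (\<phi> k (As ! i)))"
    using T by (auto simp: is_character_table_def)
  obtain s' d' \<phi>' where W2: "wedderburn_iso N ?A s' d' \<phi>'"
    and T'_eq: "T' = mat s' (length As) (\<lambda>(k, i). mat_trace (\<phi>' k (As ! i)))"
    using T' by (auto simp: is_character_table_def)
  interpret two_wedderburn N ?A s d \<phi> s' d' \<phi>'
    by unfold_locales (use alg W1 W2 in auto)
  interpret sw: two_wedderburn N ?A s' d' \<phi>' s d \<phi> ..
  have sw_linked: "sw.linked k' k \<longleftrightarrow> linked k k'" if "k < s" "k' < s'" for k k'
    using linked_if_rep_block_unit[OF that] sw.linked_if_rep_block_unit[OF that(2,1)]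
    by (auto simp: linked_def sw.linked_def)
  define p where "p k = (if k < s then SOME k'. k' < s' \<and> linked k k' else k)" for k
  have p: "p k < s'" "linked k (p k)" if "k < s" for k
    using someI_ex[of "\<lambda>k'. k' < s' \<and> linked k k'"] linked_exists[OF that] that
    by (auto simp: p_def)
  have inj: "inj_on p {..<s}"
    using p linked_left_unique by (auto intro!: inj_onI) metis
  have surj: "p ` {..<s} = {..<s'}"
  proof (intro equalityI subsetI)
    fix k' assume k': "k' \<in> {..<s'}"
    then obtain k where k: "k < s" "linked k k'"
      using sw.linked_exists[of k'] sw_linked by auto
    then have "k' = p k"
      using p[OF k(1)] k' sw.linked_left_unique[of k' "p k" k] sw_linked by auto
    with k show "k' \<in> p ` {..<s}" by auto
  qed (use p in auto)
  have "s = s'" using card_image[OF inj] surj by simp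
  then have "bij_betw p {..<s'} {..<s'}" using inj surj by (simp add: bij_betw_def)
  then have "p permutes {..<s'}"
    by (intro bij_imp_permutes) (auto simp: p_def \<open>s = s'\<close>)
  moreover have "T = mat s' (length As) (\<lambda>(k, i). T' $$ (p k, i))"
  proof (rule eq_matI)
    fix k i
    assume "k < dim_row (mat s' (length As) (\<lambda>(k, i). T' $$ (p k, i)))"
      "i < dim_col (mat s' (length As) (\<lambda>(k, i). T' $$ (p k, i)))"
    then have ki: "k < s" "i < length As" using \<open>s = s'\<close> by auto
    then have "As ! i \<in> ?A" using As by auto
    then show "T $$ (k, i) = mat s' (length As) (\<lambda>(k, i). T' $$ (p k, i)) $$ (k, i)"
      using ki p[of k] linked_traces_eq[of k "p k" "As ! i"] \<open>s = s'\<close>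
      by (simp add: T_eq T'_eq)
  qed (simp_all add: T_eq \<open>s = s'\<close>)
  ultimately show ?thesis unfolding eq_up_to_row_order_def by (auto simp: T'_eq)
qed

section \<open>Fourier analysis on the cyclic group\<close>

text \<open>Functions on \<open>\<int>/m\<close> are represented as \<open>m\<close>-periodic functions on the integers, where indices can be
  negated and subtracted freely; sums run over the representatives \<open>0, \<dots>, m - 1\<close>.\<close>

definition residue_fun :: "nat \<Rightarrow> (int \<Rightarrow> 'a) \<Rightarrow> bool" where
  "residue_fun m f \<longleftrightarrow> (\<forall>t. f (t mod int m) = f t)"

lemma residue_fun_mod: "residue_fun m f \<Longrightarrow> f (t mod int m) = f t"
  by (simp add: residue_fun_def)

lemma residue_fun_cong: "residue_fun m f \<Longrightarrow> s mod int m = t mod int m \<Longrightarrow> f s = f t"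
  by (metis residue_fun_def)

lemma residue_fun_comp:
  assumes "residue_fun m f"
  shows "residue_fun m (\<lambda>t. f (t + c))" "residue_fun m (\<lambda>t. f (t - c))"
    and "residue_fun m (\<lambda>t. f (c - t))" "residue_fun m (\<lambda>t. f (c * t))" "residue_fun m (\<lambda>t. f (t * c))"
  unfolding residue_fun_def
  by (intro allI residue_fun_cong[OF assms]; simp add: mod_simps)+

lemma residue_fun_binary:
  assumes "residue_fun m f" "residue_fun m g"
  shows "residue_fun m (\<lambda>t. h (f t) (g t))"
  using assms by (simp add: residue_fun_def)

text \<open>Substitution in a sum over \<open>\<int>/m\<close>: the maps \<open>k\<close> and \<open>l\<close> induce mutually inverse permutations of
  the residues.\<close>

lemma sum_residues_bij:
  fixes f :: "int \<Rightarrow> 'a :: comm_monoid_add"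
  assumes "0 < m" "residue_fun m f" "\<And>t. (k (l t)) mod int m = t mod int m" "\<And>t. (l (k t)) mod int m = t mod int m"
    and "residue_fun m (\<lambda>t. k t mod int m)" "residue_fun m (\<lambda>t. l t mod int m)"
  shows "(\<Sum>t<m. f (k (int t))) = (\<Sum>t<m. f (int t))"
proof (rule sum.reindex_bij_witness[where i = "\<lambda>t. nat (l (int t) mod int m)"
      and j = "\<lambda>t. nat (k (int t) mod int m)"])
  fix t assume "t \<in> {..<m}"
  then have t: "t < m" by simp
  have "l (k (int t) mod int m) mod int m = int t"
    using residue_fun_mod[OF assms(6), of "k (int t)"] assms(4)[of "int t"] t by simp
  then show "nat (l (int (nat (k (int t) mod int m))) mod int m) = t"
    using assms(1) by simp
  have "k (l (int t) mod int m) mod int m = int t"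
    using residue_fun_mod[OF assms(5), of "l (int t)"] assms(3)[of "int t"] t by simp
  then show "nat (k (int (nat (l (int t) mod int m))) mod int m) = t"
    using assms(1) by simp
  show "nat (k (int t) mod int m) \<in> {..<m}" "nat (l (int t) mod int m) \<in> {..<m}"
    using assms(1) by (auto simp: nat_less_iff)
  show "f (int (nat (k (int t) mod int m))) = f (k (int t))"
    using assms(1) by (simp add: residue_fun_mod[OF assms(2)])
qed

lemma sum_residues_shift:
  fixes f :: "int \<Rightarrow> 'a :: comm_monoid_add"
  assumes "0 < m" "residue_fun m f"
  shows "(\<Sum>t<m. f (int t + c)) = (\<Sum>t<m. f (int t))"
    and "(\<Sum>t<m. f (c - int t)) = (\<Sum>t<m. f (int t))"
  by (rule sum_residues_bij[OF assms, where l = "\<lambda>t. t - c"];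
      simp add: residue_fun_def mod_simps)
     (rule sum_residues_bij[OF assms, where l = "\<lambda>t. c - t"];
      simp add: residue_fun_def mod_simps)

definition root_power :: "nat \<Rightarrow> int \<Rightarrow> complex" where
  "root_power m k = cis (2 * pi * of_int k / of_nat m)"

lemma root_power_add: "root_power m (k + l) = root_power m k * root_power m l"
  by (simp add: root_power_def cis_mult add_divide_distrib distrib_left)

lemma root_power_0 [simp]: "root_power m 0 = 1"
  by (simp add: root_power_def)

lemma root_power_of_nat: "root_power m (k * int t) = root_power m k ^ t"
  by (induction t) (simp_all add: distrib_left root_power_add)

lemma root_power_eq_1_iff:
  assumes "0 < m"
  shows "root_power m k = 1 \<longleftrightarrow> int m dvd k"
proof
  assume "root_power m k = 1"
  then obtain q :: int where "2 * pi * of_int k / of_nat m = of_int q * (2 * pi)"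
    by (auto simp: root_power_def cis_eq_1_iff)
  then have "(of_int k :: real) = of_int (q * int m)"
    using assms by (simp add: field_simps)
  then have "k = q * int m" by linarith
  then show "int m dvd k" by simp
next
  assume "int m dvd k"
  then obtain q where "k = int m * q" by blast
  moreover have "cis (2 * pi * of_int q) = 1" by (rule cis_multiple_2pi) simp
  ultimately show "root_power m k = 1" using assms by (simp add: root_power_def mult.assoc)
qed

lemma residue_fun_root_power:
  assumes "0 < m"
  shows "residue_fun m (root_power m)"
proof -
  have "root_power m t = root_power m (t mod int m)" for t
  proof -
    have "root_power m (int m * (t div int m)) = 1" using assms by (simp add: root_power_eq_1_iff)
    then show ?thesis
      using root_power_add[of m "int m * (t div int m)" "t mod int m"] by simp
  qed
  then show ?thesis by (simp add: residue_fun_def)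
qed

lemma sum_root_power:
  assumes "0 < m"
  shows "(\<Sum>t<m. root_power m (k * int t)) = (if int m dvd k then of_nat m else 0)"
proof (cases "root_power m k = 1")
  case True
  then have "int m dvd k" using root_power_eq_1_iff[OF assms] by blast
  with True show ?thesis by (simp add: root_power_of_nat)
next
  case False
  have "root_power m k ^ m = 1"
    using root_power_eq_1_iff[OF assms, of "k * int m"] by (simp flip: root_power_of_nat)
  then show ?thesis
    using False assms by (simp add: root_power_of_nat geometric_sum root_power_eq_1_iff)
qed

lemma residue_fun_twist:
  assumes "0 < m" "residue_fun m f"
  shows "residue_fun m (\<lambda>t. f t * root_power m (\<beta> * t))"
  by (rule residue_fun_binary[OF assms(2) residue_fun_comp(4)[OF residue_fun_root_power[OF assms(1)]]])

definition dft :: "nat \<Rightarrow> (int \<Rightarrow> complex) \<Rightarrow> int \<Rightarrow> complex" where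
  "dft m f \<beta> = (\<Sum>t<m. f (int t) * root_power m (\<beta> * int t))"

lemma dft_add: "dft m (\<lambda>t. f t + g t) \<beta> = dft m f \<beta> + dft m g \<beta>"
  by (simp add: dft_def sum.distrib distrib_right)

lemma dft_cmult: "dft m (\<lambda>t. c * f t) \<beta> = c * dft m f \<beta>"
  by (simp add: dft_def sum_distrib_left mult.assoc)

lemma dft_const: "0 < m \<Longrightarrow> dft m (\<lambda>_. c) \<beta> = (if int m dvd \<beta> then of_nat m * c else 0)"
  by (simp add: dft_def sum_root_power flip: sum_distrib_left)

lemma dft_zero: "dft m (\<lambda>_. 0) \<beta> = 0"
  by (simp add: dft_def)

lemma dft_0: "dft m f 0 = (\<Sum>t<m. f (int t))"
  by (simp add: dft_def)

lemma residue_fun_dft: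
  assumes "0 < m"
  shows "residue_fun m (dft m f)"
  unfolding residue_fun_def dft_def
  using residue_fun_comp(5)[OF residue_fun_root_power[OF assms]]
  by (auto simp: residue_fun_def)

text \<open>Interchanging the two sums leaves, by orthogonality of the roots of unity, only the term with
  \<open>t \<equiv> s\<close>.\<close>

lemma dft_inversion:
  assumes m: "0 < m" and f: "residue_fun m f"
  shows "(\<Sum>\<beta><m. dft m f (int \<beta>) * root_power m (- s * int \<beta>)) = of_nat m * f s"
proof -
  have "(\<Sum>\<beta><m. dft m f (int \<beta>) * root_power m (- s * int \<beta>)) =
    (\<Sum>\<beta><m. \<Sum>t<m. f (int t) * root_power m ((int t - s) * int \<beta>))"
    unfolding dft_def sum_distrib_right
    by (intro sum.cong refl) (simp add: mult.assoc algebra_simps flip: root_power_add)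
  also have "\<dots> = (\<Sum>t<m. f (int t) * (if int m dvd int t - s then of_nat m else 0))"
    by (subst sum.swap) (simp add: sum_root_power[OF m] flip: sum_distrib_left)
  also have "\<dots> = (\<Sum>t<m. if t = nat (s mod int m) then f (int t) * of_nat m else 0)"
  proof (intro sum.cong refl)
    fix t assume "t \<in> {..<m}"
    then have "int m dvd int t - s \<longleftrightarrow> t = nat (s mod int m)"
      using m by (auto simp: mod_eq_dvd_iff[symmetric])
    then show "f (int t) * (if int m dvd int t - s then of_nat m else 0) =
      (if t = nat (s mod int m) then f (int t) * of_nat m else 0)" by simp
  qed
  also have "\<dots> = of_nat m * f s"
    using m by (simp add: residue_fun_mod[OF f] nat_less_iff)
  finally show ?thesis .
qed

lemma dft_inj:
  assumes "0 < m" "residue_fun m f" "residue_fun m g"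
    and "\<And>\<beta>. \<beta> < m \<Longrightarrow> dft m f (int \<beta>) = dft m g (int \<beta>)"
  shows "f = g"
proof
  fix s
  have "of_nat m * f s = of_nat m * g s"
    using assms by (simp flip: dft_inversion)
  then show "f s = g s" using assms(1) by simp
qed

text \<open>By inversion, a prescribed transform is attained at the reflected transform of \<open>F / m\<close>.\<close>

lemma dft_surj:
  assumes m: "0 < m"
  shows "\<exists>f. residue_fun m f \<and> (\<forall>\<beta><m. dft m f (int \<beta>) = F \<beta>)"
proof -
  define G where "G \<beta> = F (nat (\<beta> mod int m)) / of_nat m" for \<beta> :: int
  have G: "residue_fun m G" by (simp add: residue_fun_def G_def)
  define f where "f s = dft m G (- s)" for s
  have "residue_fun m f"
    unfolding f_def using residue_fun_comp(3)[OF residue_fun_dft[OF m], of G 0] by simp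
  moreover have "dft m f (int \<beta>) = F \<beta>" if "\<beta> < m" for \<beta>
  proof -
    have "dft m f (int \<beta>) = (\<Sum>t<m. dft m G (int t) * root_power m (- int \<beta> * int t))"
      using sum_residues_shift(2)[OF m residue_fun_twist[OF m residue_fun_dft[OF m, of G], of "- int \<beta>"], of 0]
      by (simp add: dft_def[of m f] f_def)
    also have "\<dots> = F \<beta>" using that m by (simp only: dft_inversion[OF m G]) (simp add: G_def)
    finally show ?thesis .
  qed
  ultimately show ?thesis by blast
qed

definition conv :: "nat \<Rightarrow> (int \<Rightarrow> complex) \<Rightarrow> (int \<Rightarrow> complex) \<Rightarrow> int \<Rightarrow> complex" where
  "conv m f g s = (\<Sum>t<m. f (int t) * g (s - int t))"

definition corr :: "nat \<Rightarrow> (int \<Rightarrow> complex) \<Rightarrow> (int \<Rightarrow> complex) \<Rightarrow> int \<Rightarrow> complex" where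
  "corr m f g s = (\<Sum>t<m. f (int t) * g (int t - s))"

lemma residue_fun_conv: "residue_fun m g \<Longrightarrow> residue_fun m (conv m f g)"
  unfolding residue_fun_def[of m "conv m f g"] conv_def
  by (auto intro!: sum.cong residue_fun_cong[of m g] simp: mod_simps)

lemma residue_fun_corr: "residue_fun m g \<Longrightarrow> residue_fun m (corr m f g)"
  unfolding residue_fun_def[of m "corr m f g"] corr_def
  by (auto intro!: sum.cong residue_fun_cong[of m g] simp: mod_simps)

lemma dft_conv:
  assumes m: "0 < m" and g: "residue_fun m g"
  shows "dft m (conv m f g) \<beta> = dft m f \<beta> * dft m g \<beta>"
proof -
  have inner: "(\<Sum>s<m. g (int s - int t) * root_power m (\<beta> * int s)) = root_power m (\<beta> * int t) * dft m g \<beta>"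
    for t
  proof -
    have "(\<Sum>s<m. g (int s + (- int t)) * root_power m (\<beta> * (int s + (- int t)))) = dft m g \<beta>"
      using sum_residues_shift(1)[OF m residue_fun_twist[OF m g, of \<beta>], of "- int t"]
      by (simp add: dft_def)
    then have "root_power m (\<beta> * int t) * dft m g \<beta> =
      (\<Sum>s<m. root_power m (\<beta> * int t) * (g (int s - int t) * root_power m (\<beta> * (int s - int t))))"
      by (simp flip: sum_distrib_left)
    also have "\<dots> = (\<Sum>s<m. g (int s - int t) * root_power m (\<beta> * int s))"
    proof (intro sum.cong refl)
      fix s
      have "root_power m (\<beta> * int s) = root_power m (\<beta> * int t) * root_power m (\<beta> * (int s - int t))"
        by (simp add: algebra_simps flip: root_power_add)
      then show "root_power m (\<beta> * int t) * (g (int s - int t) * root_power m (\<beta> * (int s - int t))) =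
        g (int s - int t) * root_power m (\<beta> * int s)"
        by (simp only: mult.left_commute)
    qed
    finally show ?thesis by simp
  qed
  have "dft m (conv m f g) \<beta> = (\<Sum>t<m. f (int t) * (\<Sum>s<m. g (int s - int t) * root_power m (\<beta> * int s)))"
    unfolding dft_def conv_def sum_distrib_right sum_distrib_left
    by (subst sum.swap) (simp add: mult.assoc)
  then show ?thesis unfolding inner by (simp add: dft_def sum_distrib_right mult.assoc)
qed

lemma dft_reflect:
  assumes m: "0 < m" and g: "residue_fun m g"
  shows "dft m (\<lambda>t. g (- t)) \<beta> = dft m g (- \<beta>)"
  using sum_residues_shift(2)[OF m residue_fun_twist[OF m g, of "- \<beta>"], of 0]
  by (simp add: dft_def)

text \<open>The correlation with \<open>g\<close> is the convolution with the reflection of \<open>g\<close>, and reflection of a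
  function reflects its transform.\<close>

lemma dft_corr:
  assumes m: "0 < m" and g: "residue_fun m g"
  shows "dft m (corr m f g) \<beta> = dft m f \<beta> * dft m g (- \<beta>)"
proof -
  have "corr m f g = conv m f (\<lambda>t. g (- t))" by (simp add: corr_def conv_def fun_eq_iff)
  moreover have "residue_fun m (\<lambda>t. g (- t))" using residue_fun_comp(3)[OF g, of 0] by simp
  ultimately show ?thesis by (simp add: dft_conv[OF m] dft_reflect[OF m g])
qed

definition residue_delta :: "nat \<Rightarrow> nat \<Rightarrow> int \<Rightarrow> complex" where
  "residue_delta m l t = (if t mod int m = int l mod int m then 1 else 0)"

lemma residue_fun_delta: "residue_fun m (residue_delta m l)"
  by (simp add: residue_fun_def residue_delta_def)

lemma dft_delta: "l < m \<Longrightarrow> dft m (residue_delta m l) \<beta> = root_power m (\<beta> * int l)"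
proof -
  assume l: "l < m"
  have "dft m (residue_delta m l) \<beta> = (\<Sum>t<m. if t = l then root_power m (\<beta> * int l) else 0)"
    unfolding dft_def using l by (intro sum.cong) (auto simp: residue_delta_def)
  then show ?thesis using l by simp
qed

section \<open>The adjacency algebra\<close>

lemma adjacency_algebra_linear:
  assumes "set As \<subseteq> carrier_mat N N"
  shows "set As \<subseteq> adjacency_algebra N As"
    and "X \<in> adjacency_algebra N As \<Longrightarrow> Y \<in> adjacency_algebra N As \<Longrightarrow> X + Y \<in> adjacency_algebra N As"
    and "X \<in> adjacency_algebra N As \<Longrightarrow> c \<cdot>\<^sub>m X \<in> adjacency_algebra N As"
proof -
  interpret V: vectorspace "class_ring :: complex ring" "module_mat TYPE(complex) N N"
    by (rule matrix_vs)
  have As: "set As \<subseteq> carrier (module_mat TYPE(complex) N N)"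
    using assms by (simp add: module_mat_simps)
  then show "set As \<subseteq> adjacency_algebra N As"
    unfolding adjacency_algebra_def by (rule V.in_own_span)
  interpret S: submodule class_ring "adjacency_algebra N As" "module_mat TYPE(complex) N N"
    unfolding adjacency_algebra_def by (rule V.span_is_submodule[OF As])
  show "X \<in> adjacency_algebra N As \<Longrightarrow> Y \<in> adjacency_algebra N As \<Longrightarrow> X + Y \<in> adjacency_algebra N As"
    using S.m_closed by (simp add: module_mat_simps)
  show "X \<in> adjacency_algebra N As \<Longrightarrow> c \<cdot>\<^sub>m X \<in> adjacency_algebra N As"
    using S.smult_closed[of c X] by (simp add: module_mat_simps)
qed

lemma adjacency_algebra_least:
  assumes "matrix_algebra N \<A>" "set As \<subseteq> \<A>"
  shows "adjacency_algebra N As \<subseteq> \<A>"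
proof -
  interpret V: vectorspace "class_ring :: complex ring" "module_mat TYPE(complex) N N"
    by (rule matrix_vs)
  have "0 \<cdot>\<^sub>m 1\<^sub>m N \<in> \<A>" using assms by (simp add: matrix_algebra_def)
  moreover have "0 \<cdot>\<^sub>m 1\<^sub>m N = (0\<^sub>m N N :: complex mat)" by auto
  ultimately have "submodule class_ring \<A> (module_mat TYPE(complex) N N)"
    using assms(1) V.module_axioms
    by (auto simp: submodule_def module_mat_simps matrix_algebra_def)
  then show ?thesis unfolding adjacency_algebra_def using assms(2) by (intro V.span_is_subset)
qed

text \<open>Only the exponents of the weighing matrix matter: its \<open>(i, j)\<close> entry is \<open>U\<^bsup>e i j\<^esup>\<close> for
  \<open>i \<noteq> j\<close>. The last assumption is the balance condition: for distinct rows \<open>i\<close> and \<open>h\<close>, every residue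
  occurs equally often among the differences of their exponents.\<close>

locale bgw_exponents =
  fixes n m :: nat and e :: "nat \<Rightarrow> nat \<Rightarrow> int"
  assumes n_pos: "0 < n" and m_pos: "0 < m"
    and e_sym: "i < n + 1 \<Longrightarrow> j < n + 1 \<Longrightarrow> e i j = e j i"
    and equidistributed: "i < n + 1 \<Longrightarrow> h < n + 1 \<Longrightarrow> i \<noteq> h \<Longrightarrow> g < m \<Longrightarrow>
      card {j. j < n + 1 \<and> j \<noteq> i \<and> j \<noteq> h \<and> (e i j - e h j) mod int m = int g} * m = n - 1"
begin

definition N :: nat where "N = (n + 1) * m"

text \<open>As \<open>R\<close> has its ones where the indices add up to \<open>m - 1\<close>, the matrix \<open>U\<^sup>k R\<close> has a one at
  \<open>(\<alpha>, \<gamma>)\<close> iff \<open>k \<equiv> - 1 - \<gamma> - \<alpha>\<close> modulo \<open>m\<close>. For \<open>k = e i j + l\<close>,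
  solving this for \<open>l\<close> gives the argument of \<open>b\<close> below.\<close>

definition entry :: "(int \<Rightarrow> complex) \<Rightarrow> (int \<Rightarrow> complex) \<Rightarrow> nat \<Rightarrow> int \<Rightarrow> nat \<Rightarrow> int \<Rightarrow> complex" where
  "entry a b i \<alpha> j \<gamma> = (if i = j then a (\<gamma> - \<alpha>) else b (- 1 - \<gamma> - \<alpha> - e i j))"

text \<open>The linear combination of the scheme matrices in which \<open>A\<^bsub>l,0\<^esub>\<close> has coefficient \<open>a l\<close> and
  \<open>A\<^bsub>l,1\<^esub>\<close> has coefficient \<open>b l\<close>, when \<open>a\<close> and \<open>b\<close> are \<open>m\<close>-periodic. All matrices of the
  adjacency algebra have this form, and working with it avoids linear combinations.\<close>

definition scheme_mat :: "(int \<Rightarrow> complex) \<Rightarrow> (int \<Rightarrow> complex) \<Rightarrow> complex mat" where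
  "scheme_mat a b = mat N N (\<lambda>(x, y). entry a b (x div m) (int (x mod m)) (y div m) (int (y mod m)))"

lemma scheme_mat_carrier [simp]: "scheme_mat a b \<in> carrier_mat N N"
  by (simp add: scheme_mat_def)

lemma block_index:
  assumes "x < N"
  obtains i \<alpha> where "i < n + 1" "\<alpha> < m" "x = i * m + \<alpha>"
proof
  show "x div m < n + 1" using assms by (simp add: N_def less_mult_imp_div_less)
  show "x mod m < m" "x = x div m * m + x mod m" using m_pos by simp_all
qed

lemma block_index_less: "i < n + 1 \<Longrightarrow> \<alpha> < m \<Longrightarrow> i * m + \<alpha> < N"
proof -
  assume "i < n + 1" "\<alpha> < m"
  then have "i * m + \<alpha> < (i + 1) * m" "(i + 1) * m \<le> N" by (auto simp: N_def intro: mult_right_mono)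
  then show ?thesis by linarith
qed

lemma block_div_mod: "\<alpha> < m \<Longrightarrow> (i * m + \<alpha>) div m = i" "\<alpha> < m \<Longrightarrow> (i * m + \<alpha>) mod m = \<alpha>"
  by simp_all

lemma scheme_mat_index:
  assumes "i < n + 1" "\<alpha> < m" "j < n + 1" "\<gamma> < m"
  shows "scheme_mat a b $$ (i * m + \<alpha>, j * m + \<gamma>) = entry a b i (int \<alpha>) j (int \<gamma>)"
  using assms block_index_less[of i \<alpha>] block_index_less[of j \<gamma>] by (simp add: scheme_mat_def)

lemma eq_mat_blockI:
  assumes "X \<in> carrier_mat N N" "Y \<in> carrier_mat N N"
    and "\<And>i \<alpha> j \<gamma>. i < n + 1 \<Longrightarrow> \<alpha> < m \<Longrightarrow> j < n + 1 \<Longrightarrow> \<gamma> < m \<Longrightarrow>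
      X $$ (i * m + \<alpha>, j * m + \<gamma>) = Y $$ (i * m + \<alpha>, j * m + \<gamma>)"
  shows "X = Y"
proof (rule eq_matI)
  fix x y assume "x < dim_row Y" "y < dim_col Y"
  then have "x < N" "y < N" using assms by auto
  then show "X $$ (x, y) = Y $$ (x, y)"
    using assms(3) by (elim block_index) blast
qed (use assms in auto)

lemma scheme_mat_add: "scheme_mat a b + scheme_mat a' b' = scheme_mat (\<lambda>t. a t + a' t) (\<lambda>t. b t + b' t)"
  by (rule eq_matI) (auto simp: scheme_mat_def entry_def)

lemma scheme_mat_smult: "c \<cdot>\<^sub>m scheme_mat a b = scheme_mat (\<lambda>t. c * a t) (\<lambda>t. c * b t)"
  by (rule eq_matI) (auto simp: scheme_mat_def entry_def)

lemma sum_blocks: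
  fixes f :: "nat \<Rightarrow> complex"
  shows "(\<Sum>x<N. f x) = (\<Sum>j<n + 1. \<Sum>\<gamma><m. f (j * m + \<gamma>))"
proof -
  have "(\<Sum>x<N. f x) = (\<Sum>p\<in>{..<n + 1} \<times> {..<m}. f (fst p * m + snd p))"
    by (rule sum.reindex_bij_witness[where i = "\<lambda>p. fst p * m + snd p" and j = "\<lambda>x. (x div m, x mod m)"])
       (auto simp: N_def less_mult_imp_div_less m_pos intro: block_index_less[unfolded N_def, simplified])
  then show ?thesis by (simp add: sum.cartesian_product split_def)
qed

text \<open>Here the balance condition enters: sorting the columns \<open>j\<close> by the residue of
  \<open>e i j - e h j\<close> gives classes of equal size.\<close>

lemma sum_off_diagonal:
  fixes c :: "int \<Rightarrow> complex"
  assumes ih: "i < n + 1" "h < n + 1" "i \<noteq> h" and c: "residue_fun m c"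
  shows "of_nat m * (\<Sum>j\<in>{..<n + 1} - {i, h}. c (e i j - e h j)) = of_nat (n - 1) * (\<Sum>g<m. c (int g))"
proof -
  let ?S = "{..<n + 1} - {i, h}" and ?r = "\<lambda>j. nat ((e i j - e h j) mod int m)"
  have "(\<Sum>j\<in>?S. c (e i j - e h j)) = (\<Sum>g<m. \<Sum>j\<in>{j\<in>?S. ?r j = g}. c (e i j - e h j))"
    by (rule sum.group[symmetric]) (auto simp: nat_less_iff m_pos)
  also have "of_nat m * \<dots> = (\<Sum>g<m. of_nat (n - 1) * c (int g))"
  proof (subst sum_distrib_left, intro sum.cong refl)
    fix g assume g: "g \<in> {..<m}"
    have set_eq: "{j\<in>?S. ?r j = g} =
      {j. j < n + 1 \<and> j \<noteq> i \<and> j \<noteq> h \<and> (e i j - e h j) mod int m = int g}"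
      using m_pos by auto
    have "(\<Sum>j\<in>{j\<in>?S. ?r j = g}. c (e i j - e h j)) = (\<Sum>j\<in>{j\<in>?S. ?r j = g}. c (int g))"
    proof (intro sum.cong refl)
      fix j assume "j \<in> {j\<in>?S. ?r j = g}"
      then have "(e i j - e h j) mod int m = int g" using m_pos by auto
      then show "c (e i j - e h j) = c (int g)" by (metis residue_fun_mod[OF c])
    qed
    moreover have "of_nat m * (of_nat (card {j\<in>?S. ?r j = g}) :: complex) = of_nat (n - 1)"
      using equidistributed[OF ih, of g] g unfolding set_eq of_nat_mult[symmetric] by (simp add: mult.commute)
    ultimately show "of_nat m * (\<Sum>j\<in>{j\<in>?S. ?r j = g}. c (e i j - e h j)) = of_nat (n - 1) * c (int g)"
      by (simp only: sum_constant mult.assoc[symmetric])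
  qed
  finally show ?thesis by (simp add: sum_distrib_left)
qed

text \<open>The multiplication table of the scheme in terms of coefficient functions. As
  \<open>R U R = U\<^sup>-\<^sup>1\<close> and the exponents are symmetric,
  \<open>A\<^bsub>k,0\<^esub> A\<^bsub>l,0\<^esub> = A\<^bsub>k+l,0\<^esub>\<close>, \<open>A\<^bsub>k,0\<^esub> A\<^bsub>l,1\<^esub> = A\<^bsub>k+l,1\<^esub>\<close>,
  \<open>A\<^bsub>l,1\<^esub> A\<^bsub>k,0\<^esub> = A\<^bsub>l-k,1\<^esub>\<close>, and \<open>A\<^bsub>l,1\<^esub> A\<^bsub>k,1\<^esub>\<close> is the sum of \<open>n A\<^bsub>l-k,0\<^esub>\<close> (from the
  diagonal blocks) and \<open>(n - 1) / m\<close> times the sum of all \<open>A\<^bsub>j,1\<^esub>\<close> (from the off-diagonal blocks, by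
  the balance condition). These rules give convolutions and correlations.\<close>

lemma scheme_mat_mult:
  assumes a': "residue_fun m a'" and b: "residue_fun m b" and b': "residue_fun m b'" and a: "residue_fun m a"
  shows "scheme_mat a b * scheme_mat a' b' = scheme_mat
    (\<lambda>s. conv m a a' s + of_nat n * corr m b b' s)
    (\<lambda>s. conv m a b' s + corr m b a' s + of_nat (n - 1) / of_nat m * (dft m b 0 * dft m b' 0))"
    (is "_ = scheme_mat ?a ?b")
proof (rule eq_mat_blockI)
  fix i \<alpha> h \<beta>
  assume idx: "i < n + 1" "\<alpha> < m" "h < n + 1" "\<beta> < m"
  \<comment> \<open>the contribution of the intermediate block \<open>j\<close> to the entry of the product\<close>
  define inner where "inner j = (\<Sum>\<gamma><m. entry a b i (int \<alpha>) j (int \<gamma>) * entry a' b' j (int \<gamma>) h (int \<beta>))" for j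
  have "(scheme_mat a b * scheme_mat a' b') $$ (i * m + \<alpha>, h * m + \<beta>) =
    (\<Sum>j<n + 1. \<Sum>\<gamma><m. scheme_mat a b $$ (i * m + \<alpha>, j * m + \<gamma>) * scheme_mat a' b' $$ (j * m + \<gamma>, h * m + \<beta>))"
    using idx block_index_less
    by (subst index_mult_mat_sum[OF scheme_mat_carrier scheme_mat_carrier]) (simp_all only: sum_blocks)
  also have "\<dots> = (\<Sum>j<n + 1. inner j)"
    unfolding inner_def using idx by (intro sum.cong refl) (simp add: scheme_mat_index)
  finally have prod: "(scheme_mat a b * scheme_mat a' b') $$ (i * m + \<alpha>, h * m + \<beta>) = (\<Sum>j<n + 1. inner j)" .
  show "(scheme_mat a b * scheme_mat a' b') $$ (i * m + \<alpha>, h * m + \<beta>) =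
    scheme_mat ?a ?b $$ (i * m + \<alpha>, h * m + \<beta>)"
  proof (cases "i = h")
    case True
    have "inner i = conv m a a' (int \<beta> - int \<alpha>)"
      using sum_residues_shift(1)[OF m_pos residue_fun_binary[OF a residue_fun_comp(3)[OF a', of "int \<beta> - int \<alpha>"],
          of "(*)"], of "- int \<alpha>"] True
      by (simp add: inner_def entry_def conv_def)
    moreover have "inner j = corr m b b' (int \<beta> - int \<alpha>)" if "j < n + 1" "j \<noteq> i" for j
      using sum_residues_shift(2)[OF m_pos residue_fun_binary[OF b residue_fun_comp(2)[OF b', of "int \<beta> - int \<alpha>"],
          of "(*)"], of "- 1 - int \<alpha> - e i j"] True that e_sym[of j i] idx
      by (simp add: inner_def entry_def corr_def algebra_simps)
    moreover have "(\<Sum>j<n + 1. inner j) = inner i + (\<Sum>j\<in>{..<n + 1} - {i}. inner j)"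
      using idx by (intro sum.remove) auto
    ultimately have "(\<Sum>j<n + 1. inner j) = conv m a a' (int \<beta> - int \<alpha>) + of_nat n * corr m b b' (int \<beta> - int \<alpha>)"
      using idx by simp
    then show ?thesis
      unfolding prod using idx True by (simp add: scheme_mat_index entry_def)
  next
    case False
    let ?s = "- 1 - int \<beta> - int \<alpha> - e i h"
    \<comment> \<open>Substituting for \<open>\<gamma>\<close> the argument of \<open>b\<close> shows that an intermediate block other than
      \<open>i\<close> and \<open>h\<close> contributes a function of the exponent difference alone.\<close>
    define c where "c u = (\<Sum>t<m. b (int t) * b' (u + (int t + int \<alpha> - int \<beta>)))" for u
    have c: "residue_fun m c"
      unfolding residue_fun_def c_def
      by (auto intro!: sum.cong residue_fun_cong[OF b'] simp: mod_simps)
    have "inner i = conv m a b' ?s"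
      using sum_residues_shift(1)[OF m_pos residue_fun_binary[OF a residue_fun_comp(3)[OF b', of ?s],
          of "(*)"], of "- int \<alpha>"] False
      by (simp add: inner_def entry_def conv_def algebra_simps)
    moreover have "inner h = corr m b a' ?s"
      using sum_residues_shift(2)[OF m_pos residue_fun_binary[OF b residue_fun_comp(2)[OF a', of ?s],
          of "(*)"], of "- 1 - int \<alpha> - e i h"] False
      by (simp add: inner_def entry_def corr_def algebra_simps)
    moreover have "inner j = c (e i j - e h j)" if "j < n + 1" "j \<noteq> i" "j \<noteq> h" for j
      using sum_residues_shift(2)[OF m_pos residue_fun_binary[OF b
          residue_fun_comp(1)[OF b', of "int \<alpha> - int \<beta> + (e i j - e h j)"],
          of "(*)"], of "- 1 - int \<alpha> - e i j"] that e_sym[of j h] idx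
      by (simp add: inner_def entry_def c_def algebra_simps)
    moreover have "(\<Sum>j\<in>{..<n + 1} - {i, h}. c (e i j - e h j)) =
      of_nat (n - 1) / of_nat m * (dft m b 0 * dft m b' 0)"
    proof -
      have "(\<Sum>g<m. c (int g)) = (\<Sum>t<m. b (int t) * (\<Sum>g<m. b' (int g + (int t + int \<alpha> - int \<beta>))))"
        unfolding c_def sum_distrib_left by (rule sum.swap)
      also have "\<dots> = dft m b 0 * dft m b' 0"
        by (simp add: sum_residues_shift(1)[OF m_pos b'] dft_0 sum_distrib_right)
      finally show ?thesis
        using sum_off_diagonal[OF idx(1,3) False c] m_pos by (simp add: field_simps)
    qed
    moreover have "(\<Sum>j<n + 1. inner j) = inner i + (inner h + (\<Sum>j\<in>{..<n + 1} - {i, h}. inner j))"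
    proof -
      have "{..<n + 1} - {i} - {h} = {..<n + 1} - {i, h}" by auto
      then show ?thesis
        using idx False sum.remove[of "{..<n + 1}" i inner] sum.remove[of "{..<n + 1} - {i}" h inner]
        by simp
    qed
    ultimately show ?thesis
      using idx False by (simp add: prod scheme_mat_index entry_def)
  qed
qed (rule mult_carrier_mat[OF scheme_mat_carrier scheme_mat_carrier], rule scheme_mat_carrier)

definition scheme_algebra :: "complex mat set" where
  "scheme_algebra = {scheme_mat a b | a b. residue_fun m a \<and> residue_fun m b}"

lemma scheme_mat_in_algebra: "residue_fun m a \<Longrightarrow> residue_fun m b \<Longrightarrow> scheme_mat a b \<in> scheme_algebra"
  by (auto simp: scheme_algebra_def)

lemma scheme_mat_one: "scheme_mat (residue_delta m 0) (\<lambda>_. 0) = 1\<^sub>m N"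
proof (rule eq_mat_blockI)
  fix i \<alpha> j \<gamma> assume idx: "i < n + 1" "\<alpha> < m" "j < n + 1" "\<gamma> < m"
  have "(int \<gamma> - int \<alpha>) mod int m = 0 \<longleftrightarrow> \<gamma> = \<alpha>"
    using idx by (simp add: mod_eq_dvd_iff[symmetric] mod_eq_0_iff_dvd)
  moreover have "i * m + \<alpha> = j * m + \<gamma> \<longleftrightarrow> i = j \<and> \<alpha> = \<gamma>"
    using block_div_mod[of \<alpha> i] block_div_mod[of \<gamma> j] idx by metis
  ultimately show "scheme_mat (residue_delta m 0) (\<lambda>_. 0) $$ (i * m + \<alpha>, j * m + \<gamma>) =
    1\<^sub>m N $$ (i * m + \<alpha>, j * m + \<gamma>)"
    using idx block_index_less[of i \<alpha>] block_index_less[of j \<gamma>]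
    by (auto simp: scheme_mat_index entry_def residue_delta_def)
qed simp_all

lemma matrix_algebra_scheme_algebra: "matrix_algebra N scheme_algebra"
  unfolding matrix_algebra_def
proof (intro conjI ballI allI)
  show "scheme_algebra \<subseteq> carrier_mat N N" by (auto simp: scheme_algebra_def)
  show "1\<^sub>m N \<in> scheme_algebra"
  proof -
    have "residue_fun m (\<lambda>_. 0 :: complex)" by (simp add: residue_fun_def)
    then show ?thesis
      unfolding scheme_mat_one[symmetric] scheme_algebra_def using residue_fun_delta[of m 0] by blast
  qed
  fix X Y assume "X \<in> scheme_algebra" "Y \<in> scheme_algebra"
  then obtain a b a' b' where ab: "X = scheme_mat a b" "Y = scheme_mat a' b'"
    "residue_fun m a" "residue_fun m b" "residue_fun m a'" "residue_fun m b'"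
    by (auto simp: scheme_algebra_def)
  show "X + Y \<in> scheme_algebra"
    unfolding ab scheme_mat_add
    by (rule scheme_mat_in_algebra) (use ab(3-6) in \<open>simp_all add: residue_fun_def\<close>)
  show "X * Y \<in> scheme_algebra"
    unfolding ab(1,2) scheme_mat_mult[OF ab(5,4,6,3)]
    by (rule scheme_mat_in_algebra)
       (use ab(3-6)[THEN residue_fun_conv] ab(3-6)[THEN residue_fun_corr] in \<open>simp_all add: residue_fun_def\<close>)
next
  fix c X assume "X \<in> scheme_algebra"
  then obtain a b where ab: "X = scheme_mat a b" "residue_fun m a" "residue_fun m b"
    by (auto simp: scheme_algebra_def)
  show "c \<cdot>\<^sub>m X \<in> scheme_algebra"
    unfolding ab scheme_mat_smult
    by (rule scheme_mat_in_algebra) (use ab(2,3) in \<open>simp_all add: residue_fun_def\<close>)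
qed

definition scheme_list :: "complex mat list" where
  "scheme_list = map (\<lambda>l. scheme_mat (residue_delta m l) (\<lambda>_. 0)) [0..<m]
     @ map (\<lambda>l. scheme_mat (\<lambda>_. 0) (residue_delta m l)) [0..<m]"

lemma set_scheme_list:
  "set scheme_list = (\<lambda>l. scheme_mat (residue_delta m l) (\<lambda>_. 0)) ` {..<m}
     \<union> (\<lambda>l. scheme_mat (\<lambda>_. 0) (residue_delta m l)) ` {..<m}"
  by (auto simp: scheme_list_def)

lemma scheme_list_subset: "set scheme_list \<subseteq> scheme_algebra"
proof -
  have "residue_fun m (\<lambda>_. 0 :: complex)" by (simp add: residue_fun_def)
  then show ?thesis
    using residue_fun_delta[of m] unfolding set_scheme_list scheme_algebra_def by blast
qed

text \<open>An additive property that holds for the multiples of the indicator functions of single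
  residues holds for all \<open>m\<close>-periodic functions, which are finite sums of those.\<close>

lemma residue_fun_induct:
  assumes a: "residue_fun m a"
    and add: "\<And>f g. P f \<Longrightarrow> P g \<Longrightarrow> P (\<lambda>t. f t + g t)"
    and delta: "\<And>c l. l < m \<Longrightarrow> P (\<lambda>t. c * residue_delta m l t)"
  shows "P a"
proof -
  have "P (\<lambda>t. if t mod int m < int k then a t else 0)" if "k \<le> m" for k
    using that
  proof (induction k)
    case 0
    have "(\<lambda>t. if t mod int m < int 0 then a t else 0) = (\<lambda>t. 0 * residue_delta m 0 t)"
      using pos_mod_sign[of "int m"] m_pos by (simp add: not_less[symmetric] del: pos_mod_sign)
    then show ?case using delta[of 0 0] m_pos by simp
  next
    case (Suc k)
    have "(\<lambda>t. if t mod int m < int (Suc k) then a t else 0) =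
      (\<lambda>t. (if t mod int m < int k then a t else 0) + a (int k) * residue_delta m k t)"
    proof
      fix t
      show "(if t mod int m < int (Suc k) then a t else 0) =
        (if t mod int m < int k then a t else 0) + a (int k) * residue_delta m k t"
        using residue_fun_mod[OF a, of t] Suc.prems
        by (cases "t mod int m" "int k" rule: linorder_cases) (auto simp: residue_delta_def)
    qed
    then show ?case using add[OF Suc.IH delta] Suc.prems by simp
  qed
  from this[of m] show ?thesis using m_pos by simp
qed

lemma scheme_mat_split: "scheme_mat a b = scheme_mat a (\<lambda>_. 0) + scheme_mat (\<lambda>_. 0) b"
  by (simp add: scheme_mat_add)

lemma adjacency_algebra_scheme_list: "adjacency_algebra N scheme_list = scheme_algebra"
proof
  note sub = scheme_list_subset
  then have carrier: "set scheme_list \<subseteq> carrier_mat N N"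
    by (auto simp: scheme_algebra_def)
  show "adjacency_algebra N scheme_list \<subseteq> scheme_algebra"
    by (rule adjacency_algebra_least[OF matrix_algebra_scheme_algebra sub])
  show "scheme_algebra \<subseteq> adjacency_algebra N scheme_list"
  proof
    fix X assume "X \<in> scheme_algebra"
    then obtain a b where X: "X = scheme_mat a b" and a: "residue_fun m a" and b: "residue_fun m b"
      by (auto simp: scheme_algebra_def)
    have "scheme_mat a (\<lambda>_. 0) \<in> adjacency_algebra N scheme_list"
      using a
    proof (rule residue_fun_induct)
      fix f g
      assume "scheme_mat f (\<lambda>_. 0) \<in> adjacency_algebra N scheme_list"
        "scheme_mat g (\<lambda>_. 0) \<in> adjacency_algebra N scheme_list"
      from adjacency_algebra_linear(2)[OF carrier this]
      show "scheme_mat (\<lambda>t. f t + g t) (\<lambda>_. 0) \<in> adjacency_algebra N scheme_list"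
        by (simp add: scheme_mat_add)
    next
      fix c l assume "l < m"
      then have "scheme_mat (residue_delta m l) (\<lambda>_. 0) \<in> adjacency_algebra N scheme_list"
        using adjacency_algebra_linear(1)[OF carrier] by (auto simp: set_scheme_list)
      from adjacency_algebra_linear(3)[OF carrier this, of c]
      show "scheme_mat (\<lambda>t. c * residue_delta m l t) (\<lambda>_. 0) \<in> adjacency_algebra N scheme_list"
        by (simp add: scheme_mat_smult)
    qed
    moreover have "scheme_mat (\<lambda>_. 0) b \<in> adjacency_algebra N scheme_list"
      using b
    proof (rule residue_fun_induct)
      fix f g
      assume "scheme_mat (\<lambda>_. 0) f \<in> adjacency_algebra N scheme_list"
        "scheme_mat (\<lambda>_. 0) g \<in> adjacency_algebra N scheme_list"
      from adjacency_algebra_linear(2)[OF carrier this]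
      show "scheme_mat (\<lambda>_. 0) (\<lambda>t. f t + g t) \<in> adjacency_algebra N scheme_list"
        by (simp add: scheme_mat_add)
    next
      fix c l assume "l < m"
      then have "scheme_mat (\<lambda>_. 0) (residue_delta m l) \<in> adjacency_algebra N scheme_list"
        using adjacency_algebra_linear(1)[OF carrier] by (auto simp: set_scheme_list)
      from adjacency_algebra_linear(3)[OF carrier this, of c]
      show "scheme_mat (\<lambda>_. 0) (\<lambda>t. c * residue_delta m l t) \<in> adjacency_algebra N scheme_list"
        by (simp add: scheme_mat_smult)
    qed
    ultimately show "X \<in> adjacency_algebra N scheme_list"
      unfolding X by (subst scheme_mat_split) (rule adjacency_algebra_linear(2)[OF carrier])
  qed
qed

lemma transpose_scheme_mat:
  "transpose_mat (scheme_mat a b) = scheme_mat (\<lambda>t. a (- t)) b"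
proof (rule eq_mat_blockI)
  fix i \<alpha> j \<gamma> assume idx: "i < n + 1" "\<alpha> < m" "j < n + 1" "\<gamma> < m"
  then show "transpose_mat (scheme_mat a b) $$ (i * m + \<alpha>, j * m + \<gamma>) =
    scheme_mat (\<lambda>t. a (- t)) b $$ (i * m + \<alpha>, j * m + \<gamma>)"
    using block_index_less[of i \<alpha>] block_index_less[of j \<gamma>] e_sym[of j i]
      carrier_matD[OF scheme_mat_carrier[of a b]]
    by (simp add: scheme_mat_index entry_def) (auto simp: algebra_simps)
qed simp_all

lemma residue_delta_reflect:
  "residue_delta m l (- t) = residue_delta m (nat (- int l mod int m)) t"
proof -
  have "- t mod int m = int l mod int m \<longleftrightarrow> t mod int m = - int l mod int m"
    by (metis minus_minus mod_minus_cong)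
  then show ?thesis using m_pos by (simp add: residue_delta_def)
qed

lemma reflect_reflect_mod: "(- 1 - (- 1 - t - c) mod k - c) mod k = t mod k" for k :: int
proof -
  have "(- 1 - (- 1 - t - c) mod k - c) mod k = (- 1 - c - (- 1 - t - c) mod k) mod k"
    by (simp add: algebra_simps)
  also have "\<dots> = (- 1 - c - (- 1 - t - c)) mod k" by (rule mod_diff_right_eq)
  finally show ?thesis by simp
qed

lemma association_scheme_scheme_list: "association_scheme N scheme_list"
  unfolding association_scheme_def
proof (intro conjI ballI)
  show "scheme_list \<noteq> []" "scheme_list ! 0 = 1\<^sub>m N"
    using m_pos scheme_mat_one by (simp_all add: scheme_list_def nth_append)
  fix A assume A: "A \<in> set scheme_list"
  then show carrier: "A \<in> carrier_mat N N" by (auto simp: set_scheme_list)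
  show "elements_mat A \<subseteq> {0, 1}"
  proof -
    have "residue_delta m l t \<in> {0, 1}" for l t by (simp add: residue_delta_def)
    then have "entry a b i \<alpha> j \<gamma> \<in> {0, 1}"
      if "a = residue_delta m l \<and> b = (\<lambda>_. 0) \<or> a = (\<lambda>_. 0) \<and> b = residue_delta m l"
      for a b l i \<alpha> j \<gamma>
      using that by (auto simp: entry_def)
    moreover obtain a b l where "a = residue_delta m l \<and> b = (\<lambda>_. 0) \<or> a = (\<lambda>_. 0) \<and> b = residue_delta m l"
      and "A = scheme_mat a b"
      using A unfolding set_scheme_list by blast
    ultimately have "A $$ (x, y) \<in> {0, 1}" if "x < N" "y < N" for x y
      using that unfolding scheme_mat_def by simp
    moreover have "dim_row A = N" "dim_col A = N" using carrier by auto
    ultimately show ?thesis by (metis elements_matD subsetI)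
  qed
  obtain l where l: "l < m"
    and "A = scheme_mat (residue_delta m l) (\<lambda>_. 0) \<or> A = scheme_mat (\<lambda>_. 0) (residue_delta m l)"
    using A by (auto simp: set_scheme_list)
  then consider (diag) "A = scheme_mat (residue_delta m l) (\<lambda>_. 0)"
    | (off) "A = scheme_mat (\<lambda>_. 0) (residue_delta m l)" by blast
  note cases = this
  show "A \<noteq> 0\<^sub>m N N"
    using cases
  proof cases
    case diag
    then have "A $$ (0 * m + 0, 0 * m + l) = 1"
      using l by (subst diag, subst scheme_mat_index) (auto simp: entry_def residue_delta_def)
    then show ?thesis using l block_index_less[of 0 l] by auto
  next
    case off
    define \<gamma> where "\<gamma> = nat ((- 1 - int l - e 0 1) mod int m)"
    have \<gamma>: "\<gamma> < m" "int \<gamma> = (- 1 - int l - e 0 1) mod int m" using m_pos by (simp_all add: \<gamma>_def nat_less_iff)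
    then have "A $$ (0 * m + 0, 1 * m + \<gamma>) = 1"
      using l n_pos by (subst off, subst scheme_mat_index) (auto simp: entry_def residue_delta_def reflect_reflect_mod)
    then show ?thesis using \<gamma> m_pos n_pos block_index_less[of 1 \<gamma>] by auto
  qed
  show "transpose_mat A \<in> set scheme_list"
    using cases
  proof cases
    case diag
    have "nat (- int l mod int m) < m" using m_pos by (simp add: nat_less_iff)
    then show ?thesis
      unfolding diag transpose_scheme_mat residue_delta_reflect set_scheme_list by auto
  next
    case off
    then show ?thesis using l unfolding off transpose_scheme_mat set_scheme_list by auto
  qed
  fix B assume "B \<in> set scheme_list"
  then show "A * B \<in> adjacency_algebra N scheme_list"
    using A matrix_algebra_scheme_algebra scheme_list_subset
    unfolding adjacency_algebra_scheme_list matrix_algebra_def by blast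
next
  show "mat N N (\<lambda>(x, y). \<Sum>A\<leftarrow>scheme_list. A $$ (x, y)) = all_ones_mat N"
  proof (rule eq_mat_blockI)
    fix i \<alpha> j \<gamma> assume idx: "i < n + 1" "\<alpha> < m" "j < n + 1" "\<gamma> < m"
    have delta: "(\<Sum>l<m. residue_delta m l t) = 1" for t
    proof -
      have "(\<Sum>l<m. residue_delta m l t) = (\<Sum>l<m. if l = nat (t mod int m) then 1 else 0)"
        using m_pos by (intro sum.cong) (auto simp: residue_delta_def)
      then show ?thesis using m_pos by (simp add: nat_less_iff)
    qed
    show "mat N N (\<lambda>(x, y). \<Sum>A\<leftarrow>scheme_list. A $$ (x, y)) $$ (i * m + \<alpha>, j * m + \<gamma>) =
      all_ones_mat N $$ (i * m + \<alpha>, j * m + \<gamma>)"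
      using idx block_index_less[of i \<alpha>] block_index_less[of j \<gamma>]
      by (cases "i = j") (simp_all add: all_ones_mat_def scheme_list_def o_def scheme_mat_index
          interv_sum_list_conv_sum_set_nat atLeast0LessThan entry_def delta)
  qed (simp_all add: all_ones_mat_def)
qed

section \<open>The irreducible representations\<close>

text \<open>The coefficient functions of an element of the algebra can be read off its first row: the first
  from block 0, the second from block 1, which exists since \<open>n > 0\<close>. The column for the second one
  is found by solving \<open>t \<equiv> - 1 - \<gamma> - e 0 1\<close> for \<open>\<gamma>\<close>.\<close>

definition diag_coeff :: "complex mat \<Rightarrow> int \<Rightarrow> complex" where
  "diag_coeff X t = X $$ (0, nat (t mod int m))"

definition off_coeff :: "complex mat \<Rightarrow> int \<Rightarrow> complex" where
  "off_coeff X t = X $$ (0, m + nat ((- 1 - t - e 0 1) mod int m))"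

lemma coeff_scheme_mat:
  assumes a: "residue_fun m a" and b: "residue_fun m b"
  shows "diag_coeff (scheme_mat a b) = a" and "off_coeff (scheme_mat a b) = b"
proof -
  show "diag_coeff (scheme_mat a b) = a"
  proof
    fix t
    have "nat (t mod int m) < m" using m_pos by (simp add: nat_less_iff)
    then show "diag_coeff (scheme_mat a b) t = a t"
      using scheme_mat_index[of 0 0 0 "nat (t mod int m)" a b] m_pos
      by (simp add: diag_coeff_def entry_def residue_fun_mod[OF a])
  qed
  show "off_coeff (scheme_mat a b) = b"
  proof
    fix t
    let ?u = "- 1 - t - e 0 1"
    have "nat (?u mod int m) < m" using m_pos by (simp add: nat_less_iff)
    moreover have "b (- 1 - ?u mod int m - e 0 1) = b t"
      by (rule residue_fun_cong[OF b]) (rule reflect_reflect_mod)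
    ultimately show "off_coeff (scheme_mat a b) t = b t"
      using scheme_mat_index[of 0 0 1 "nat (?u mod int m)" a b] m_pos n_pos
      by (simp add: off_coeff_def entry_def)
  qed
qed

text \<open>The one-dimensional representations send \<open>A\<^bsub>l,0\<^esub>\<close> to \<open>w\<^bsup>\<beta>l\<^esup>\<close> and \<open>A\<^bsub>l,1\<^esub>\<close> to
  \<open>c w\<^bsup>\<beta>l\<^esup>\<close>.\<close>

definition rep1 :: "int \<Rightarrow> complex \<Rightarrow> complex mat \<Rightarrow> complex mat" where
  "rep1 \<beta> c X = mat 1 1 (\<lambda>_. dft m (diag_coeff X) \<beta> + c * dft m (off_coeff X) \<beta>)"

text \<open>The two-dimensional representations send \<open>A\<^bsub>l,0\<^esub>\<close> to the diagonal matrix with entries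
  \<open>w\<^bsup>\<beta>l\<^esup>\<close> and \<open>w\<^bsup>-\<beta>l\<^esup>\<close>, and \<open>A\<^bsub>0,1\<^esub>\<close> to \<open>\<surd>n\<close> times the flip of the two coordinates, which
  conjugates these diagonal matrices to their inverses.\<close>

definition rep2 :: "int \<Rightarrow> complex mat \<Rightarrow> complex mat" where
  "rep2 \<beta> X = mat 2 2 (\<lambda>(r, s).
     if r = s then dft m (diag_coeff X) (if r = 0 then \<beta> else - \<beta>)
     else of_real (sqrt n) * dft m (off_coeff X) (if r = 0 then \<beta> else - \<beta>))"

lemma coeff_add:
  assumes "X \<in> scheme_algebra" "Y \<in> scheme_algebra"
  shows "diag_coeff (X + Y) = (\<lambda>t. diag_coeff X t + diag_coeff Y t)"
    and "off_coeff (X + Y) = (\<lambda>t. off_coeff X t + off_coeff Y t)"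
proof -
  obtain a b a' b' where ab: "X = scheme_mat a b" "Y = scheme_mat a' b'"
    "residue_fun m a" "residue_fun m b" "residue_fun m a'" "residue_fun m b'"
    using assms by (auto simp: scheme_algebra_def)
  have "residue_fun m (\<lambda>t. a t + a' t)" "residue_fun m (\<lambda>t. b t + b' t)"
    using ab by (simp_all add: residue_fun_def)
  then show "diag_coeff (X + Y) = (\<lambda>t. diag_coeff X t + diag_coeff Y t)"
    "off_coeff (X + Y) = (\<lambda>t. off_coeff X t + off_coeff Y t)"
    using ab by (simp_all add: scheme_mat_add coeff_scheme_mat)
qed

lemma coeff_smult:
  assumes "X \<in> scheme_algebra"
  shows "diag_coeff (c \<cdot>\<^sub>m X) = (\<lambda>t. c * diag_coeff X t)"
    and "off_coeff (c \<cdot>\<^sub>m X) = (\<lambda>t. c * off_coeff X t)"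
proof -
  obtain a b where ab: "X = scheme_mat a b" "residue_fun m a" "residue_fun m b"
    using assms by (auto simp: scheme_algebra_def)
  have "residue_fun m (\<lambda>t. c * a t)" "residue_fun m (\<lambda>t. c * b t)"
    using ab by (simp_all add: residue_fun_def)
  then show "diag_coeff (c \<cdot>\<^sub>m X) = (\<lambda>t. c * diag_coeff X t)"
    "off_coeff (c \<cdot>\<^sub>m X) = (\<lambda>t. c * off_coeff X t)"
    using ab by (simp_all add: scheme_mat_smult coeff_scheme_mat)
qed

text \<open>In the Fourier picture the product becomes pointwise, up to a twist: moving a power of \<open>U\<close> past
  \<open>R\<close> inverts it, whence the frequencies \<open>- \<beta>\<close>. The last term is the transform of a constant, which
  lives at the trivial frequency only.\<close>

lemma dft_coeff_mult:
  assumes "X \<in> scheme_algebra" "Y \<in> scheme_algebra"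
  shows "dft m (diag_coeff (X * Y)) \<beta> = dft m (diag_coeff X) \<beta> * dft m (diag_coeff Y) \<beta>
      + of_nat n * (dft m (off_coeff X) \<beta> * dft m (off_coeff Y) (- \<beta>))"
    and "dft m (off_coeff (X * Y)) \<beta> = dft m (diag_coeff X) \<beta> * dft m (off_coeff Y) \<beta>
      + dft m (off_coeff X) \<beta> * dft m (diag_coeff Y) (- \<beta>)
      + (if int m dvd \<beta> then of_nat (n - 1) * (dft m (off_coeff X) 0 * dft m (off_coeff Y) 0) else 0)"
proof -
  obtain a b a' b' where ab: "X = scheme_mat a b" "Y = scheme_mat a' b'"
    and res: "residue_fun m a" "residue_fun m b" "residue_fun m a'" "residue_fun m b'"
    using assms by (auto simp: scheme_algebra_def)
  have prod: "residue_fun m (\<lambda>s. conv m a a' s + of_nat n * corr m b b' s)"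
    "residue_fun m (\<lambda>s. conv m a b' s + corr m b a' s + of_nat (n - 1) / of_nat m * (dft m b 0 * dft m b' 0))"
    using res[THEN residue_fun_conv] res[THEN residue_fun_corr] by (simp_all add: residue_fun_def)
  show "dft m (diag_coeff (X * Y)) \<beta> = dft m (diag_coeff X) \<beta> * dft m (diag_coeff Y) \<beta>
      + of_nat n * (dft m (off_coeff X) \<beta> * dft m (off_coeff Y) (- \<beta>))"
    unfolding ab scheme_mat_mult[OF res(3,2,4,1)] coeff_scheme_mat[OF prod] coeff_scheme_mat[OF res(1,2)] coeff_scheme_mat[OF res(3,4)]
    using res m_pos by (simp add: dft_add dft_cmult dft_conv dft_corr)
  show "dft m (off_coeff (X * Y)) \<beta> = dft m (diag_coeff X) \<beta> * dft m (off_coeff Y) \<beta>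
      + dft m (off_coeff X) \<beta> * dft m (diag_coeff Y) (- \<beta>)
      + (if int m dvd \<beta> then of_nat (n - 1) * (dft m (off_coeff X) 0 * dft m (off_coeff Y) 0) else 0)"
    unfolding ab scheme_mat_mult[OF res(3,2,4,1)] coeff_scheme_mat[OF prod] coeff_scheme_mat[OF res(1,2)] coeff_scheme_mat[OF res(3,4)]
    using res m_pos by (simp add: dft_add dft_conv dft_corr dft_const)
qed

lemma dft_coeff_one: "dft m (diag_coeff (1\<^sub>m N)) \<beta> = 1" "dft m (off_coeff (1\<^sub>m N)) \<beta> = 0"
proof -
  have res: "residue_fun m (residue_delta m 0)" "residue_fun m (\<lambda>_. 0 :: complex)"
    by (rule residue_fun_delta) (simp add: residue_fun_def)
  show "dft m (diag_coeff (1\<^sub>m N)) \<beta> = 1" "dft m (off_coeff (1\<^sub>m N)) \<beta> = 0"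
    unfolding scheme_mat_one[symmetric] coeff_scheme_mat[OF res]
    using m_pos by (simp_all add: dft_delta dft_zero)
qed

text \<open>The first condition says that \<open>\<beta>\<close> and \<open>- \<beta>\<close> are the same frequency. The second is the relation
  \<open>A\<^bsub>0,1\<^esub>\<^sup>2 = n I + ((n - 1) / m) \<Sum>\<^sub>j A\<^bsub>j,1\<^esub>\<close> with \<open>c\<close> in place of \<open>A\<^bsub>0,1\<^esub>\<close>: its solutions are \<open>n\<close> and
  \<open>- 1\<close> at the trivial frequency and \<open>\<plusminus>\<surd>n\<close> at the other one.\<close>

lemma algebra_rep_rep1:
  assumes \<beta>: "int m dvd 2 * \<beta>" and c: "c * c = of_nat n + (if int m dvd \<beta> then of_nat (n - 1) * c else 0)"
  shows "algebra_rep N scheme_algebra 1 (rep1 \<beta> c)"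
  unfolding algebra_rep_def
proof (intro conjI ballI allI)
  show "rep1 \<beta> c \<in> scheme_algebra \<rightarrow> carrier_mat 1 1" by (simp add: rep1_def)
  show "rep1 \<beta> c (1\<^sub>m N) = 1\<^sub>m 1" by (rule eq_matI) (simp_all add: rep1_def dft_coeff_one)
  fix X Y assume XY: "X \<in> scheme_algebra" "Y \<in> scheme_algebra"
  show "rep1 \<beta> c (X + Y) = rep1 \<beta> c X + rep1 \<beta> c Y"
    by (rule eq_matI) (simp_all add: rep1_def coeff_add[OF XY] dft_add algebra_simps)
  have neg: "dft m f (- \<beta>) = dft m f \<beta>" for f
    using \<beta> by (intro residue_fun_cong[OF residue_fun_dft[OF m_pos]])
      (metis diff_minus_eq_add mod_eq_dvd_iff mult_2)
  have zero: "dft m f \<beta> = dft m f 0" if "int m dvd \<beta>" for f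
    using that by (intro residue_fun_cong[OF residue_fun_dft[OF m_pos]]) simp
  have "dft m (diag_coeff (X * Y)) \<beta> + c * dft m (off_coeff (X * Y)) \<beta> =
    (dft m (diag_coeff X) \<beta> + c * dft m (off_coeff X) \<beta>) * (dft m (diag_coeff Y) \<beta> + c * dft m (off_coeff Y) \<beta>)"
    (is "?l = (?p + c * ?q) * (?r + c * ?s)")
  proof -
    have "?l = ?p * ?r + c * ?p * ?s + c * ?q * ?r
      + (of_nat n + (if int m dvd \<beta> then of_nat (n - 1) * c else 0)) * (?q * ?s)"
      using zero by (simp add: dft_coeff_mult[OF XY] neg algebra_simps)
    then show ?thesis unfolding c[symmetric] by (simp add: algebra_simps)
  qed
  then show "rep1 \<beta> c (X * Y) = rep1 \<beta> c X * rep1 \<beta> c Y"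
    by (intro eq_matI) (simp_all add: rep1_def scalar_prod_def)
next
  fix k X assume "X \<in> scheme_algebra"
  then show "rep1 \<beta> c (k \<cdot>\<^sub>m X) = k \<cdot>\<^sub>m rep1 \<beta> c X"
    by (intro eq_matI) (simp_all add: rep1_def coeff_smult dft_cmult algebra_simps)
qed

lemma algebra_rep_rep2:
  assumes \<beta>: "\<not> int m dvd \<beta>"
  shows "algebra_rep N scheme_algebra 2 (rep2 \<beta>)"
  unfolding algebra_rep_def
proof (intro conjI ballI allI)
  show "rep2 \<beta> \<in> scheme_algebra \<rightarrow> carrier_mat 2 2" by (simp add: rep2_def)
  show "rep2 \<beta> (1\<^sub>m N) = 1\<^sub>m 2" by (rule eq_matI) (auto simp: rep2_def dft_coeff_one)
  fix X Y assume XY: "X \<in> scheme_algebra" "Y \<in> scheme_algebra"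
  show "rep2 \<beta> (X + Y) = rep2 \<beta> X + rep2 \<beta> Y"
    by (rule eq_matI) (auto simp: rep2_def coeff_add[OF XY] dft_add algebra_simps)
  have sqrt: "complex_of_real (sqrt n) * (complex_of_real (sqrt n) * z) = of_nat n * z" for z
    by (simp flip: mult.assoc of_real_mult)
  show "rep2 \<beta> (X * Y) = rep2 \<beta> X * rep2 \<beta> Y"
  proof (rule eq_matI)
    fix r s assume "r < dim_row (rep2 \<beta> X * rep2 \<beta> Y)" "s < dim_col (rep2 \<beta> X * rep2 \<beta> Y)"
    then have "r = 0 \<or> r = 1" "s = 0 \<or> s = 1" by (auto simp: rep2_def)
    then show "rep2 \<beta> (X * Y) $$ (r, s) = (rep2 \<beta> X * rep2 \<beta> Y) $$ (r, s)"
      using \<beta> sqrt by (auto simp: rep2_def scalar_prod_def dft_coeff_mult[OF XY] numeral_2_eq_2 algebra_simps)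
  qed (simp_all add: rep2_def)
next
  fix k X assume "X \<in> scheme_algebra"
  then show "rep2 \<beta> (k \<cdot>\<^sub>m X) = k \<cdot>\<^sub>m rep2 \<beta> X"
    by (intro eq_matI) (auto simp: rep2_def coeff_smult dft_cmult algebra_simps)
qed

text \<open>A representation is listed with its degree. The order of the list is that of the rows of the
  expected character table.\<close>

definition irreps1 :: "(nat \<times> (complex mat \<Rightarrow> complex mat)) list" where
  "irreps1 = [(1, rep1 (int 0) (of_nat n)), (1, rep1 (int 0) (- 1))] @
     (if even m then [(1, rep1 (int (m div 2)) (of_real (sqrt n))),
                      (1, rep1 (int (m div 2)) (- of_real (sqrt n)))] else [])"

definition irreps :: "(nat \<times> (complex mat \<Rightarrow> complex mat)) list" where
  "irreps = irreps1 @ map (\<lambda>\<beta>. (2, rep2 (int \<beta>))) [1..<(m + 1) div 2]"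

lemma irreps_are_reps:
  assumes "(r, \<phi>) \<in> set irreps"
  shows "0 < r \<and> algebra_rep N scheme_algebra r \<phi>"
proof -
  have "algebra_rep N scheme_algebra 1 (rep1 0 (of_nat n))"
    using n_pos by (intro algebra_rep_rep1) (simp_all add: algebra_simps of_nat_diff)
  moreover have "algebra_rep N scheme_algebra 1 (rep1 0 (- 1))"
    using n_pos by (intro algebra_rep_rep1) (simp_all add: of_nat_diff)
  moreover have "algebra_rep N scheme_algebra 1 (rep1 (int (m div 2)) c)"
    if "even m" "c * c = of_nat n" for c
  proof (rule algebra_rep_rep1)
    show "int m dvd 2 * int (m div 2)" using that by auto
    have "\<not> m dvd m div 2" using m_pos that(1) by (auto dest!: dvd_imp_le)
    then have "\<not> int m dvd int (m div 2)" by (metis of_nat_dvd_iff)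
    then show "c * c = of_nat n + (if int m dvd int (m div 2) then of_nat (n - 1) * c else 0)"
      using that by simp
  qed
  moreover have "complex_of_real (sqrt n) * complex_of_real (sqrt n) = of_nat n"
    by (simp flip: of_real_mult)
  moreover have "algebra_rep N scheme_algebra 2 (rep2 (int \<beta>))" if "\<beta> \<in> {1..<(m + 1) div 2}" for \<beta>
  proof (rule algebra_rep_rep2)
    have "\<not> m dvd \<beta>" using that by (auto dest!: dvd_imp_le)
    then show "\<not> int m dvd int \<beta>" by simp
  qed
  ultimately show ?thesis
    using assms by (auto simp: irreps_def irreps1_def split: if_splits)
qed

text \<open>The frequencies are grouped as in the list of representations: 0, \<open>m / 2\<close>, and the pairs
  \<open>\<plusminus>\<beta>\<close> with the representative \<open>\<beta>\<close> below \<open>m / 2\<close>.\<close>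

lemma residue_cases:
  assumes "\<beta> < m"
  obtains (zero) "\<beta> = 0" | (half) "even m" "\<beta> = m div 2"
    | (low) "\<beta> \<in> {1..<(m + 1) div 2}"
    | (high) "m - \<beta> \<in> {1..<(m + 1) div 2}" "2 * \<beta> > m"
proof -
  consider "2 * \<beta> = m" | "2 * \<beta> < m" | "2 * \<beta> > m" by linarith
  then show ?thesis
  proof cases
    case 1 then show ?thesis using half by auto
  next
    case 2 then show ?thesis using zero low by (cases "\<beta> = 0") auto
  next
    case 3
    then have "1 \<le> m - \<beta>" "m - \<beta> < (m + 1) div 2" using assms by linarith+
    then show ?thesis using high 3 by auto
  qed
qed

lemma dft_neg_complement: "\<beta> < m \<Longrightarrow> dft m f (- int (m - \<beta>)) = dft m f (int \<beta>)"
  by (rule residue_fun_cong[OF residue_fun_dft[OF m_pos]]) (simp add: of_nat_diff)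

text \<open>The representations determine the transforms of both coefficient functions at every frequency:
  at 0 and \<open>m / 2\<close> from two independent linear combinations, at the other frequencies from matrix
  entries.\<close>

lemma irreps_separate:
  assumes X: "X \<in> scheme_algebra" and Y: "Y \<in> scheme_algebra"
    and eq: "\<And>r \<phi>. (r, \<phi>) \<in> set irreps \<Longrightarrow> \<phi> X = \<phi> Y"
  shows "X = Y"
proof -
  obtain a b a' b' where ab: "X = scheme_mat a b" "Y = scheme_mat a' b'"
    and res: "residue_fun m a" "residue_fun m b" "residue_fun m a'" "residue_fun m b'"
    using X Y by (auto simp: scheme_algebra_def)
  note coeff = coeff_scheme_mat[OF res(1,2)] coeff_scheme_mat[OF res(3,4)]
  have eq1: "dft m a \<beta> + c * dft m b \<beta> = dft m a' \<beta> + c * dft m b' \<beta>"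
    if "(1, rep1 \<beta> c) \<in> set irreps" for \<beta> c
    using arg_cong[OF eq[OF that], of "\<lambda>M. M $$ (0, 0)"] by (simp add: ab rep1_def coeff)
  have eq2: "dft m a (int \<beta>) = dft m a' (int \<beta>)" "dft m a (- int \<beta>) = dft m a' (- int \<beta>)"
    "dft m b (int \<beta>) = dft m b' (int \<beta>)" "dft m b (- int \<beta>) = dft m b' (- int \<beta>)"
    if "\<beta> \<in> {1..<(m + 1) div 2}" for \<beta>
  proof -
    have "(2, rep2 (int \<beta>)) \<in> set irreps" using that by (auto simp: irreps_def)
    note M = eq[OF this]
    show "dft m a (int \<beta>) = dft m a' (int \<beta>)" "dft m a (- int \<beta>) = dft m a' (- int \<beta>)"
      "dft m b (int \<beta>) = dft m b' (int \<beta>)" "dft m b (- int \<beta>) = dft m b' (- int \<beta>)"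
      using arg_cong[OF M, of "\<lambda>M. M $$ (0, 0)"] arg_cong[OF M, of "\<lambda>M. M $$ (1, 1)"]
        arg_cong[OF M, of "\<lambda>M. M $$ (0, 1)"] arg_cong[OF M, of "\<lambda>M. M $$ (1, 0)"] n_pos
      by (simp_all add: ab rep2_def coeff)
  qed
  have "dft m a (int \<beta>) = dft m a' (int \<beta>) \<and> dft m b (int \<beta>) = dft m b' (int \<beta>)"
    if "\<beta> < m" for \<beta>
    using that
  proof (cases \<beta> rule: residue_cases)
    case zero
    have e1: "dft m a 0 + of_nat n * dft m b 0 = dft m a' 0 + of_nat n * dft m b' 0"
      and e2: "dft m a 0 - dft m b 0 = dft m a' 0 - dft m b' 0"
      using eq1[of 0 "of_nat n"] eq1[of 0 "- 1"] by (simp_all add: irreps_def irreps1_def)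
    have "of_nat (n + 1) * dft m b 0 = (dft m a 0 + of_nat n * dft m b 0) - (dft m a 0 - dft m b 0)"
      by (simp add: algebra_simps)
    also have "\<dots> = of_nat (n + 1) * dft m b' 0" unfolding e1 e2 by (simp add: algebra_simps)
    finally have "dft m b 0 = dft m b' 0" by (simp only: mult_cancel_left of_nat_eq_0_iff) simp
    then show ?thesis using e2 zero by simp
  next
    case half
    let ?h = "int (m div 2)" and ?c = "complex_of_real (sqrt n)"
    have e1: "dft m a ?h + ?c * dft m b ?h = dft m a' ?h + ?c * dft m b' ?h"
      and e2: "dft m a ?h - ?c * dft m b ?h = dft m a' ?h - ?c * dft m b' ?h"
      using eq1[of ?h ?c] eq1[of ?h "- ?c"] half by (simp_all add: irreps_def irreps1_def)
    have "2 * dft m a ?h = (dft m a ?h + ?c * dft m b ?h) + (dft m a ?h - ?c * dft m b ?h)" by simp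
    also have "\<dots> = 2 * dft m a' ?h" unfolding e1 e2 by simp
    finally have "dft m a ?h = dft m a' ?h" by simp
    then show ?thesis using e1 half n_pos by simp
  next
    case low
    then show ?thesis using eq2 by blast
  next
    case high
    then show ?thesis using eq2(2,4)[OF high(1)] unfolding dft_neg_complement[OF that] by blast
  qed
  then have "a = a'" "b = b'" using dft_inj[OF m_pos] res by blast+
  then show ?thesis by (simp add: ab)
qed

text \<open>The linear equations of the previous lemma are solved for the transforms \<open>F\<close> and \<open>G\<close> of the two
  coefficient functions.\<close>

lemma irreps_surjective:
  fixes f :: "nat \<Rightarrow> complex mat"
  assumes f: "\<And>k. k < length irreps \<Longrightarrow> f k \<in> carrier_mat (fst (irreps ! k)) (fst (irreps ! k))"
  shows "\<exists>X\<in>scheme_algebra. \<forall>k<length irreps. snd (irreps ! k) X = f k"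
proof -
  define o1 where "o1 = length irreps1"
  let ?c = "complex_of_real (sqrt n)"
  have c: "?c \<noteq> 0" using n_pos by simp
  define block where "block \<beta> = f (o1 + (\<beta> - 1))" for \<beta>
  define F where "F \<beta> =
    (if \<beta> = 0 then (f 0 $$ (0, 0) + of_nat n * f 1 $$ (0, 0)) / of_nat (n + 1)
     else if 2 * \<beta> = m then (f 2 $$ (0, 0) + f 3 $$ (0, 0)) / 2
     else if 2 * \<beta> < m then block \<beta> $$ (0, 0) else block (m - \<beta>) $$ (1, 1))" for \<beta>
  define G where "G \<beta> =
    (if \<beta> = 0 then (f 0 $$ (0, 0) - f 1 $$ (0, 0)) / of_nat (n + 1)
     else if 2 * \<beta> = m then (f 2 $$ (0, 0) - f 3 $$ (0, 0)) / (2 * ?c)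
     else if 2 * \<beta> < m then block \<beta> $$ (0, 1) / ?c else block (m - \<beta>) $$ (1, 0) / ?c)" for \<beta>
  obtain a b where a: "residue_fun m a" "\<And>\<beta>. \<beta> < m \<Longrightarrow> dft m a (int \<beta>) = F \<beta>"
    and b: "residue_fun m b" "\<And>\<beta>. \<beta> < m \<Longrightarrow> dft m b (int \<beta>) = G \<beta>"
    using dft_surj[OF m_pos, of F] dft_surj[OF m_pos, of G] by blast
  note coeff = coeff_scheme_mat[OF a(1) b(1)]
  have zero: "dft m a 0 = F 0" "dft m b 0 = G 0" using a(2)[of 0] b(2)[of 0] m_pos by simp_all
  have "snd (irreps ! k) (scheme_mat a b) = f k" if k: "k < length irreps" for k
  proof -
    consider "k = 0" | "k = 1" | (plus) "even m" "k = 2" | (minus) "even m" "k = 3"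
      | (two) \<beta> where "\<beta> \<in> {1..<(m + 1) div 2}" "k = o1 + (\<beta> - 1)"
    proof (cases "k < o1")
      case True
      then show ?thesis using that(1-4) by (cases "even m") (auto simp: o1_def irreps1_def less_Suc_eq numeral_eq_Suc)
    next
      case False
      then show ?thesis using k that(5)[of "k - o1 + 1"] by (auto simp: o1_def irreps_def)
    qed
    then show ?thesis
    proof cases
      case 1
      have "f 0 \<in> carrier_mat 1 1" using f[of 0] by (simp add: irreps_def irreps1_def)
      moreover have "F 0 + of_nat n * G 0 = f 0 $$ (0, 0)"
        by (simp add: F_def G_def field_simps del: of_nat_Suc of_nat_add)
          (simp add: algebra_simps)
      ultimately show ?thesis
        using 1 zero by (intro eq_matI) (auto simp: irreps_def irreps1_def rep1_def coeff)
    next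
      case 2
      have "f 1 \<in> carrier_mat 1 1" using f[of 1] by (simp add: irreps_def irreps1_def)
      moreover have "F 0 - G 0 = f 1 $$ (0, 0)"
        by (simp add: F_def G_def field_simps del: of_nat_Suc of_nat_add)
          (simp add: algebra_simps)
      ultimately show ?thesis
        using 2 zero by (intro eq_matI) (auto simp: irreps_def irreps1_def rep1_def coeff)
    next
      case plus
      have h: "m div 2 < m" "m div 2 \<noteq> 0" "2 * (m div 2) = m" using plus m_pos by auto
      have "f 2 \<in> carrier_mat 1 1" using f[of 2] plus by (simp add: irreps_def irreps1_def)
      moreover have "F (m div 2) + ?c * G (m div 2) = f 2 $$ (0, 0)"
        using h c by (simp add: F_def G_def field_simps)
      ultimately show ?thesis
        using plus a(2)[OF h(1)] b(2)[OF h(1)]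
        by (intro eq_matI) (auto simp: irreps_def irreps1_def rep1_def coeff)
    next
      case minus
      have h: "m div 2 < m" "m div 2 \<noteq> 0" "2 * (m div 2) = m" using minus m_pos by auto
      have "f 3 \<in> carrier_mat 1 1" using f[of 3] minus by (simp add: irreps_def irreps1_def)
      moreover have "F (m div 2) - ?c * G (m div 2) = f 3 $$ (0, 0)"
        using h c by (simp add: F_def G_def field_simps)
      ultimately show ?thesis
        using minus a(2)[OF h(1)] b(2)[OF h(1)]
        by (intro eq_matI) (auto simp: irreps_def irreps1_def rep1_def coeff)
    next
      case (two \<beta>)
      have ik: "irreps ! k = (2, rep2 (int \<beta>))"
      proof -
        have "map (\<lambda>\<beta>. (2 :: nat, rep2 (int \<beta>))) [1..<(m + 1) div 2] ! (\<beta> - 1) = (2, rep2 (int \<beta>))"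
          using two(1) by auto
        then show ?thesis by (simp only: irreps_def two(2) o1_def nth_append_length_plus)
      qed
      have fk: "f k = block \<beta>" "f k \<in> carrier_mat 2 2" using f[OF k] ik two by (simp_all add: block_def)
      have \<beta>: "\<beta> < m" "m - \<beta> < m" "\<beta> \<noteq> 0" "m - \<beta> \<noteq> 0" "2 * \<beta> < m" "m - (m - \<beta>) = \<beta>"
        "2 * (m - \<beta>) \<noteq> m" "\<not> 2 * (m - \<beta>) < m"
        using two by auto
      have neg: "dft m a (- int \<beta>) = F (m - \<beta>)" "dft m b (- int \<beta>) = G (m - \<beta>)"
        using dft_neg_complement[OF \<beta>(2)] a(2)[OF \<beta>(2)] b(2)[OF \<beta>(2)] \<beta>(6) by simp_all
      show ?thesis
      proof (rule eq_matI)
        fix r s assume "r < dim_row (f k)" "s < dim_col (f k)"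
        then have "r = 0 \<or> r = 1" "s = 0 \<or> s = 1" using fk(2) by auto
        then show "snd (irreps ! k) (scheme_mat a b) $$ (r, s) = f k $$ (r, s)"
          using c \<beta> a(2)[OF \<beta>(1)] b(2)[OF \<beta>(1)] neg
          by (auto simp: ik rep2_def coeff fk(1) F_def G_def)
      qed (use fk ik in \<open>auto simp: rep2_def\<close>)
    qed
  qed
  then show ?thesis using scheme_mat_in_algebra[OF a(1) b(1)] by blast
qed

lemma wedderburn_iso_irreps:
  "wedderburn_iso N scheme_algebra (length irreps) (\<lambda>k. fst (irreps ! k)) (\<lambda>k. snd (irreps ! k))"
  unfolding wedderburn_iso_def
proof (intro conjI allI impI)
  fix k assume "k < length irreps"
  then have k: "(fst (irreps ! k), snd (irreps ! k)) \<in> set irreps" by simp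
  from irreps_are_reps[OF this]
  show "0 < fst (irreps ! k)" "algebra_rep N scheme_algebra (fst (irreps ! k)) (snd (irreps ! k))"
    by auto
next
  let ?\<Phi> = "\<lambda>X. \<lambda>k\<in>{..<length irreps}. snd (irreps ! k) X"
  let ?P = "\<Pi>\<^sub>E k\<in>{..<length irreps}. (carrier_mat (fst (irreps ! k)) (fst (irreps ! k)) :: complex mat set)"
  have rep_carrier: "snd (irreps ! k) X \<in> carrier_mat (fst (irreps ! k)) (fst (irreps ! k))"
    if "k < length irreps" "X \<in> scheme_algebra" for k X
    using irreps_are_reps[of "fst (irreps ! k)" "snd (irreps ! k)"] that
    by (auto simp: algebra_rep_def)
  show "bij_betw ?\<Phi> scheme_algebra ?P"
    unfolding bij_betw_def
  proof
    show "inj_on ?\<Phi> scheme_algebra"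
    proof (rule inj_onI)
      fix X Y assume XY: "X \<in> scheme_algebra" "Y \<in> scheme_algebra" and eq: "?\<Phi> X = ?\<Phi> Y"
      have "snd (irreps ! k) X = snd (irreps ! k) Y" if "k < length irreps" for k
        using fun_cong[OF eq, of k] that by simp
      then have "\<phi> X = \<phi> Y" if "(r, \<phi>) \<in> set irreps" for r \<phi>
        using that by (metis in_set_conv_nth snd_conv)
      then show "X = Y" by (rule irreps_separate[OF XY])
    qed
    show "?\<Phi> ` scheme_algebra = ?P"
    proof
      show "?\<Phi> ` scheme_algebra \<subseteq> ?P" using rep_carrier by auto
      show "?P \<subseteq> ?\<Phi> ` scheme_algebra"
      proof
        fix f assume f: "f \<in> ?P"
        then obtain X where X: "X \<in> scheme_algebra" "\<forall>k<length irreps. snd (irreps ! k) X = f k"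
          using irreps_surjective[of f] by (auto simp: PiE_def Pi_def)
        then have "f = ?\<Phi> X" using f by (auto simp: PiE_def extensional_def restrict_def)
        then show "f \<in> ?\<Phi> ` scheme_algebra" using X by blast
      qed
    qed
  qed
qed

section \<open>The character table\<close>

definition character_row :: "(nat \<times> (complex mat \<Rightarrow> complex mat)) \<Rightarrow> complex vec" where
  "character_row p = vec (2 * m) (\<lambda>i. mat_trace (snd p (scheme_list ! i)))"

lemma chi_index: "\<alpha> < m \<Longrightarrow> chi m \<beta> $ \<alpha> = root_power m (int \<beta> * int \<alpha>)"
proof -
  have "exp (2 * of_real pi * \<i> / of_nat m) = root_power m 1"
    by (simp add: root_power_def cis_conv_exp mult.commute mult.left_commute)
  moreover have "root_power m (int \<beta> * int \<alpha>) = root_power m 1 ^ (\<alpha> * \<beta>)"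
    using root_power_of_nat[of m 1 "\<alpha> * \<beta>"] by (simp add: mult.commute)
  ultimately show "\<alpha> < m \<Longrightarrow> chi m \<beta> $ \<alpha> = root_power m (int \<beta> * int \<alpha>)"
    by (simp add: chi_def)
qed

lemma chi_dim [simp]: "dim_vec (chi m \<beta>) = m"
  by (simp add: chi_def)

lemma coeff_scheme_list:
  assumes "i < 2 * m"
  shows "dft m (diag_coeff (scheme_list ! i)) \<beta> = (if i < m then root_power m (\<beta> * int i) else 0)"
    and "dft m (off_coeff (scheme_list ! i)) \<beta> = (if i < m then 0 else root_power m (\<beta> * int (i - m)))"
proof -
  have z: "residue_fun m (\<lambda>_. 0 :: complex)" by (simp add: residue_fun_def)
  note c = coeff_scheme_mat[OF residue_fun_delta z] coeff_scheme_mat[OF z residue_fun_delta]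
  show "dft m (diag_coeff (scheme_list ! i)) \<beta> = (if i < m then root_power m (\<beta> * int i) else 0)"
    "dft m (off_coeff (scheme_list ! i)) \<beta> = (if i < m then 0 else root_power m (\<beta> * int (i - m)))"
    using assms by (cases "i < m"; simp add: scheme_list_def nth_append c dft_delta dft_zero)+
qed

lemma character_row_rep1:
  "character_row (r, rep1 (int \<beta>) c) = chi m \<beta> @\<^sub>v c \<cdot>\<^sub>v chi m \<beta>"
  by (rule eq_vecI)
    (simp_all add: character_row_def rep1_def mat_trace_def coeff_scheme_list chi_index)

lemma character_row_rep2:
  assumes "\<beta> \<le> m"
  shows "character_row (r, rep2 (int \<beta>)) = (chi m \<beta> + chi m (m - \<beta>)) @\<^sub>v 0\<^sub>v m"
proof (rule eq_vecI)
  fix i assume "i < dim_vec ((chi m \<beta> + chi m (m - \<beta>)) @\<^sub>v 0\<^sub>v m)"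
  then have i: "i < 2 * m" by simp
  have "root_power m (int (m - \<beta>) * int i) = root_power m (- int \<beta> * int i)"
    using assms by (intro residue_fun_cong[OF residue_fun_root_power[OF m_pos]])
      (simp add: of_nat_diff left_diff_distrib mod_eq_dvd_iff)
  then show "character_row (r, rep2 (int \<beta>)) $ i = ((chi m \<beta> + chi m (m - \<beta>)) @\<^sub>v 0\<^sub>v m) $ i"
    using i by (simp add: character_row_def rep2_def mat_trace_def coeff_scheme_list chi_index numeral_2_eq_2)
qed (simp add: character_row_def)

lemma character_rows_irreps:
  "mat (length irreps) (2 * m) (\<lambda>(k, i). mat_trace (snd (irreps ! k) (scheme_list ! i))) =
    mat_of_rows (2 * m) (map character_row irreps)"
  by (rule eq_matI) (simp_all add: mat_of_rows_def character_row_def)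

lemma character_rows_eq_table:
  "mat_of_rows (2 * m) (map character_row irreps) = (if even m then table_even n m else table_odd n m)"
proof -
  have neg: "(- c) \<cdot>\<^sub>v chi m \<beta> = - (c \<cdot>\<^sub>v chi m \<beta>)" "(- 1) \<cdot>\<^sub>v chi m \<beta> = - chi m \<beta>" for c \<beta>
    by (rule eq_vecI; simp)+
  show ?thesis
  proof (cases "even m")
    case True
    then have "(m + 1) div 2 = m div 2" by simp
    then have "map character_row irreps =
      [chi m 0 @\<^sub>v of_nat n \<cdot>\<^sub>v chi m 0, chi m 0 @\<^sub>v - chi m 0,
       chi m (m div 2) @\<^sub>v of_real (sqrt (real n)) \<cdot>\<^sub>v chi m (m div 2),
       chi m (m div 2) @\<^sub>v - of_real (sqrt (real n)) \<cdot>\<^sub>v chi m (m div 2)]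
      @ map (\<lambda>\<beta>. (chi m \<beta> + chi m (m - \<beta>)) @\<^sub>v 0\<^sub>v m) [1..<m div 2]"
      using True by (auto simp: irreps_def irreps1_def character_row_rep1 character_row_rep2 neg simp del: of_nat_0)
    then show ?thesis using True by (simp only: table_even_def if_True)
  next
    case False
    then have "(m + 1) div 2 = (m - 1) div 2 + 1" by presburger
    then have "map character_row irreps =
      [chi m 0 @\<^sub>v of_nat n \<cdot>\<^sub>v chi m 0, chi m 0 @\<^sub>v - chi m 0]
      @ map (\<lambda>\<beta>. (chi m \<beta> + chi m (m - \<beta>)) @\<^sub>v 0\<^sub>v m) [1..<(m - 1) div 2 + 1]"
      using False by (auto simp: irreps_def irreps1_def character_row_rep1 character_row_rep2 neg simp del: of_nat_0)
    then show ?thesis using False by (simp only: table_odd_def if_False)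
  qed
qed

lemma is_character_table_scheme_list:
  "is_character_table N scheme_list (if even m then table_even n m else table_odd n m)"
proof -
  have "length scheme_list = 2 * m" by (simp add: scheme_list_def)
  then show ?thesis
    unfolding is_character_table_def adjacency_algebra_scheme_list
    using wedderburn_iso_irreps character_rows_irreps character_rows_eq_table by metis
qed

end

section \<open>Weighing matrices over the cyclic group\<close>

lemma mod_eq_iff_int_mod_eq: "a mod m = b mod m \<longleftrightarrow> int a mod int m = int b mod int m"
  by (metis of_nat_eq_iff zmod_int)

lemma circ_U_carrier: "circ_U m \<in> carrier_mat m m"
  by (simp add: circ_U_def)

lemma circ_pow_carrier [simp]: "circ_U m ^\<^sub>m l \<in> carrier_mat m m"
  by (rule pow_carrier_mat[OF circ_U_carrier])

lemma circ_pow_index: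
  assumes "\<alpha> < m" "\<beta> < m"
  shows "(circ_U m ^\<^sub>m l) $$ (\<alpha>, \<beta>) = (if \<beta> = (\<alpha> + l) mod m then 1 else 0)"
  using assms
proof (induction l arbitrary: \<beta>)
  case 0
  then show ?case by (auto simp: circ_U_def)
next
  case (Suc l)
  have "(circ_U m ^\<^sub>m Suc l) $$ (\<alpha>, \<beta>) = (\<Sum>k<m. (circ_U m ^\<^sub>m l) $$ (\<alpha>, k) * circ_U m $$ (k, \<beta>))"
    using index_mult_mat_sum[OF circ_pow_carrier circ_U_carrier Suc.prems] by simp
  also have "\<dots> = (\<Sum>k<m. if k = (\<alpha> + l) mod m then circ_U m $$ (k, \<beta>) else 0)"
    using Suc.IH[OF Suc.prems(1)] by (intro sum.cong) auto
  also have "\<dots> = circ_U m $$ ((\<alpha> + l) mod m, \<beta>)"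
    using Suc.prems by simp
  also have "\<dots> = (if \<beta> = (\<alpha> + Suc l) mod m then 1 else 0)"
    using Suc.prems by (simp add: circ_U_def mod_Suc_eq)
  finally show ?case .
qed

lemma circ_pow_eq_iff:
  assumes "0 < m"
  shows "circ_U m ^\<^sub>m k = circ_U m ^\<^sub>m l \<longleftrightarrow> k mod m = l mod m"
proof
  assume "circ_U m ^\<^sub>m k = circ_U m ^\<^sub>m l"
  then have "(circ_U m ^\<^sub>m k) $$ (0, k mod m) = (circ_U m ^\<^sub>m l) $$ (0, k mod m)" by simp
  then show "k mod m = l mod m"
    using assms by (simp add: circ_pow_index split: if_splits)
next
  assume "k mod m = l mod m"
  then have "(\<alpha> + k) mod m = (\<alpha> + l) mod m" for \<alpha> by (rule mod_add_cong[OF refl])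
  then show "circ_U m ^\<^sub>m k = circ_U m ^\<^sub>m l"
    using carrier_matD[OF circ_pow_carrier[of m k]] carrier_matD[OF circ_pow_carrier[of m l]]
    by (intro eq_matI) (simp_all add: circ_pow_index)
qed

lemma circ_pow_add: "circ_U m ^\<^sub>m k * circ_U m ^\<^sub>m l = circ_U m ^\<^sub>m (k + l)"
proof (induction l)
  case 0
  then show ?case using right_mult_one_mat[OF circ_pow_carrier[of m k]] by (simp add: circ_U_def)
next
  case (Suc l)
  have "circ_U m ^\<^sub>m k * (circ_U m ^\<^sub>m l * circ_U m) = circ_U m ^\<^sub>m k * circ_U m ^\<^sub>m l * circ_U m"
    by (rule assoc_mult_mat[OF circ_pow_carrier circ_pow_carrier circ_U_carrier, symmetric])
  then show ?case using Suc by simp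
qed

lemma card_cyclic_U: "0 < m \<Longrightarrow> card (carrier (cyclic_U m)) = m"
proof -
  assume m: "0 < m"
  have "range (\<lambda>l. circ_U m ^\<^sub>m l) = (\<lambda>l. circ_U m ^\<^sub>m l) ` {..<m}"
  proof
    show "range (\<lambda>l. circ_U m ^\<^sub>m l) \<subseteq> (\<lambda>l. circ_U m ^\<^sub>m l) ` {..<m}"
    proof
      fix A assume "A \<in> range (\<lambda>l. circ_U m ^\<^sub>m l)"
      then obtain l where "A = circ_U m ^\<^sub>m l" by blast
      then have "A = circ_U m ^\<^sub>m (l mod m)" using circ_pow_eq_iff[OF m, of l "l mod m"] by simp
      then show "A \<in> (\<lambda>l. circ_U m ^\<^sub>m l) ` {..<m}" using m by simp
    qed
  qed auto
  moreover have "inj_on (\<lambda>l. circ_U m ^\<^sub>m l) {..<m}"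
    by (rule inj_onI) (simp add: circ_pow_eq_iff[OF m])
  ultimately show "card (carrier (cyclic_U m)) = m" by (simp add: cyclic_U_def card_image)
qed

lemma circ_pow_back_diag_index:
  assumes "\<alpha> < m" "\<beta> < m"
  shows "(circ_U m ^\<^sub>m l * back_diag m) $$ (\<alpha>, \<beta>) = (if (\<alpha> + l) mod m = m - 1 - \<beta> then 1 else 0)"
proof -
  have "back_diag m \<in> carrier_mat m m" by (simp add: back_diag_def)
  from index_mult_mat_sum[OF circ_pow_carrier this assms]
  have "(circ_U m ^\<^sub>m l * back_diag m) $$ (\<alpha>, \<beta>) =
    (\<Sum>k<m. (circ_U m ^\<^sub>m l) $$ (\<alpha>, k) * back_diag m $$ (k, \<beta>))" .
  also have "\<dots> = (\<Sum>k<m. if k = (\<alpha> + l) mod m then back_diag m $$ (k, \<beta>) else 0)"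
    using assms by (intro sum.cong) (auto simp: circ_pow_index)
  also have "\<dots> = back_diag m $$ ((\<alpha> + l) mod m, \<beta>)" using assms by simp
  also have "\<dots> = (if (\<alpha> + l) mod m = m - 1 - \<beta> then 1 else 0)"
    using assms by (auto simp: back_diag_def)
  finally show ?thesis .
qed

locale symmetric_cyclic_BGW =
  fixes n m :: nat and W :: "complex mat option mat"
  assumes n_pos: "0 < n" and m_pos: "0 < m"
    and bgw: "BGW (cyclic_U m) (n + 1) n (n - 1) W"
    and symmetric: "\<forall>i<n + 1. \<forall>j<n + 1. W $$ (i, j) = W $$ (j, i)"
    and zero_diagonal: "\<forall>i<n + 1. W $$ (i, i) = None"
begin

text \<open>Only the residue of an exponent modulo \<open>m\<close> is determined by \<open>W\<close>. As the choice depends on the matrix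
  entry alone, the exponents inherit the symmetry of \<open>W\<close>.\<close>

definition exponent :: "nat \<Rightarrow> nat \<Rightarrow> nat" where
  "exponent i j = (SOME k. W $$ (i, j) = Some (circ_U m ^\<^sub>m k))"

text \<open>A row has \<open>n\<close> nonzero entries among its \<open>n + 1\<close> entries, and the diagonal one is zero.\<close>

lemma W_eq_None_iff:
  assumes "i < n + 1" "j < n + 1"
  shows "W $$ (i, j) = None \<longleftrightarrow> i = j"
proof -
  have "card {j. j < n + 1 \<and> W $$ (i, j) \<noteq> None} = n"
    using bgw assms(1) unfolding BGW_def by blast
  moreover have "{j. j < n + 1 \<and> W $$ (i, j) \<noteq> None} \<subseteq> {..<n + 1} - {i}"
    using zero_diagonal by auto
  moreover have "card ({..<n + 1} - {i}) = n" using assms(1) by simp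
  ultimately have "{j. j < n + 1 \<and> W $$ (i, j) \<noteq> None} = {..<n + 1} - {i}"
    by (intro card_subset_eq) auto
  then show ?thesis using assms(2) by blast
qed

lemma W_eq_exponent:
  assumes "i < n + 1" "j < n + 1" "i \<noteq> j"
  shows "W $$ (i, j) = Some (circ_U m ^\<^sub>m exponent i j)"
proof -
  have "W \<in> carrier_mat (n + 1) (n + 1)"
    and "elements_mat W \<subseteq> insert None (Some ` range (\<lambda>l. circ_U m ^\<^sub>m l))"
    using bgw by (simp_all add: BGW_def cyclic_U_def)
  then have "W $$ (i, j) \<in> insert None (Some ` range (\<lambda>l. circ_U m ^\<^sub>m l))"
    using assms by blast
  then have "\<exists>k. W $$ (i, j) = Some (circ_U m ^\<^sub>m k)"
    using W_eq_None_iff[OF assms(1,2)] assms(3) by auto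
  then show ?thesis unfolding exponent_def by (rule someI_ex)
qed

lemma exponent_quotient:
  assumes "g < m"
  shows "(circ_U m ^\<^sub>m k) \<otimes>\<^bsub>cyclic_U m\<^esub> inv\<^bsub>cyclic_U m\<^esub> (circ_U m ^\<^sub>m l) = circ_U m ^\<^sub>m g
    \<longleftrightarrow> (int k - int l) mod int m = int g"
proof -
  have "group (cyclic_U m)" using bgw by (simp add: BGW_def)
  moreover have "circ_U m ^\<^sub>m k \<in> carrier (cyclic_U m)" for k by (simp add: cyclic_U_def)
  ultimately have "(circ_U m ^\<^sub>m k) \<otimes>\<^bsub>cyclic_U m\<^esub> inv\<^bsub>cyclic_U m\<^esub> (circ_U m ^\<^sub>m l) = circ_U m ^\<^sub>m g
    \<longleftrightarrow> circ_U m ^\<^sub>m k = (circ_U m ^\<^sub>m g) \<otimes>\<^bsub>cyclic_U m\<^esub> (circ_U m ^\<^sub>m l)"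
    using group.inv_solve_right'[of "cyclic_U m" "circ_U m ^\<^sub>m g" "circ_U m ^\<^sub>m k" "circ_U m ^\<^sub>m l"] by metis
  also have "\<dots> \<longleftrightarrow> k mod m = (g + l) mod m"
    using m_pos by (simp add: cyclic_U_def circ_pow_add circ_pow_eq_iff)
  also have "\<dots> \<longleftrightarrow> int k mod int m = (int g + int l) mod int m"
    by (simp add: mod_eq_iff_int_mod_eq)
  also have "\<dots> \<longleftrightarrow> (int k - int l) mod int m = int g mod int m"
    by (simp add: mod_eq_dvd_iff algebra_simps)
  finally show ?thesis using assms by simp
qed

sublocale bgw_exponents n m "\<lambda>i j. int (exponent i j)"
proof
  show "0 < n" "0 < m" by (rule n_pos, rule m_pos)
  fix i j :: nat assume "i < n + 1" "j < n + 1"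
  then show "int (exponent i j) = int (exponent j i)" using symmetric by (simp add: exponent_def)
next
  fix i h g :: nat assume ihg: "i < n + 1" "h < n + 1" "i \<noteq> h" "g < m"
  let ?S = "{j. j < n + 1 \<and> j \<noteq> i \<and> j \<noteq> h \<and> (int (exponent i j) - int (exponent h j)) mod int m = int g}"
  have set_eq: "{j. j < n + 1 \<and> W $$ (i, j) \<noteq> None \<and> W $$ (h, j) \<noteq> None \<and>
    the (W $$ (i, j)) \<otimes>\<^bsub>cyclic_U m\<^esub> inv\<^bsub>cyclic_U m\<^esub> (the (W $$ (h, j))) = circ_U m ^\<^sub>m g} = ?S"
  proof (rule Collect_cong, rule conj_cong[OF refl])
    fix j assume j: "j < n + 1"
    show "(W $$ (i, j) \<noteq> None \<and> W $$ (h, j) \<noteq> None \<and>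
      the (W $$ (i, j)) \<otimes>\<^bsub>cyclic_U m\<^esub> inv\<^bsub>cyclic_U m\<^esub> (the (W $$ (h, j))) = circ_U m ^\<^sub>m g) =
      (j \<noteq> i \<and> j \<noteq> h \<and> (int (exponent i j) - int (exponent h j)) mod int m = int g)"
      using W_eq_None_iff[OF ihg(1) j] W_eq_None_iff[OF ihg(2) j] W_eq_exponent[OF ihg(1) j]
        W_eq_exponent[OF ihg(2) j] exponent_quotient[OF ihg(4)] by auto
  qed
  have "circ_U m ^\<^sub>m g \<in> carrier (cyclic_U m)" by (simp add: cyclic_U_def)
  then have "real (card ?S) = real (n - 1) / real (card (carrier (cyclic_U m)))"
    unfolding set_eq[symmetric] using bgw ihg(1-3) unfolding BGW_def by blast
  then have "real (card ?S) * real m = real (n - 1)"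
    using m_pos by (simp add: card_cyclic_U)
  then show "card ?S * m = n - 1" by (simp only: of_nat_mult[symmetric] of_nat_eq_iff)
qed

lemma A0_mat_eq: "A0_mat n m l = scheme_mat (residue_delta m l) (\<lambda>_. 0)"
proof (rule eq_mat_blockI)
  show "A0_mat n m l \<in> carrier_mat N N"
    using carrier_matD[OF circ_pow_carrier[of m l]] by (simp add: A0_mat_def kronecker_def N_def)
  fix i \<alpha> j \<gamma> assume idx: "i < n + 1" "\<alpha> < m" "j < n + 1" "\<gamma> < m"
  have "\<gamma> = (\<alpha> + l) mod m \<longleftrightarrow> int \<gamma> mod int m = (int \<alpha> + int l) mod int m"
    using mod_eq_iff_int_mod_eq[of \<gamma> m "\<alpha> + l"] idx by simp
  also have "\<dots> \<longleftrightarrow> (int \<gamma> - int \<alpha>) mod int m = int l mod int m"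
    by (simp add: mod_eq_dvd_iff algebra_simps)
  finally show "A0_mat n m l $$ (i * m + \<alpha>, j * m + \<gamma>) =
    scheme_mat (residue_delta m l) (\<lambda>_. 0) $$ (i * m + \<alpha>, j * m + \<gamma>)"
    using idx block_index_less[of i \<alpha>] block_index_less[of j \<gamma>]
      carrier_matD[OF circ_pow_carrier[of m l]]
    by (simp add: A0_mat_def kronecker_def N_def scheme_mat_index circ_pow_index entry_def
        residue_delta_def del: mult_Suc)
qed simp

lemma A1_mat_eq:
  assumes "l < m"
  shows "A1_mat n m W l = scheme_mat (\<lambda>_. 0) (residue_delta m l)"
proof (rule eq_mat_blockI)
  show "A1_mat n m W l \<in> carrier_mat N N"
    unfolding A1_mat_def by (rule minus_carrier_mat) (simp add: kronecker_def all_ones_mat_def N_def)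
  fix i \<alpha> j \<gamma> assume idx: "i < n + 1" "\<alpha> < m" "j < n + 1" "\<gamma> < m"
  have less: "i * m + \<alpha> < (n + 1) * m" "j * m + \<gamma> < (n + 1) * m"
    using idx block_index_less[of i \<alpha>] block_index_less[of j \<gamma>] by (simp_all only: N_def)
  have N_entry: "N_mat n m W l $$ (i * m + \<alpha>, j * m + \<gamma>) =
    (if i = j then 1 else if (- 1 - int \<gamma> - int \<alpha> - int (exponent i j)) mod int m = int l then 1 else 0)"
  proof (cases "i = j")
    case True
    then show ?thesis
      using idx less by (simp add: N_mat_def block_mat_def all_ones_mat_def del: mult_Suc)
  next
    case False
    have "(\<alpha> + (exponent i j + l)) mod m = m - 1 - \<gamma> \<longleftrightarrow>
      (int \<alpha> + int (exponent i j) + int l) mod int m = int (m - 1 - \<gamma>) mod int m"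
      using mod_eq_iff_int_mod_eq[of "\<alpha> + (exponent i j + l)" m "m - 1 - \<gamma>"] m_pos
      by (simp add: add.assoc)
    also have "\<dots> \<longleftrightarrow> (- 1 - int \<gamma> - int \<alpha> - int (exponent i j)) mod int m = int l mod int m"
    proof -
      have "int (m - 1 - \<gamma>) = int m + (- 1 - int \<gamma>)" using idx by simp
      then have complement: "int (m - 1 - \<gamma>) mod int m = (- 1 - int \<gamma>) mod int m"
        by (simp only: mod_add_self1)
      have difference: "int \<alpha> + int (exponent i j) + int l - (- 1 - int \<gamma>) =
        - (- 1 - int \<gamma> - int \<alpha> - int (exponent i j) - int l)" by simp
      show ?thesis
        unfolding complement mod_eq_dvd_iff difference by (rule dvd_minus_iff)
    qed
    finally show ?thesis
      using idx less False W_eq_exponent[OF idx(1,3) False] assms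
      by (simp add: N_mat_def block_mat_def entry_mat_def circ_pow_add circ_pow_back_diag_index del: mult_Suc)
  qed
  have "kronecker (1\<^sub>m (n + 1)) (all_ones_mat m) $$ (i * m + \<alpha>, j * m + \<gamma>) = (if i = j then 1 else 0)"
    using idx less by (simp add: kronecker_def all_ones_mat_def del: mult_Suc)
  moreover have "kronecker (1\<^sub>m (n + 1)) (all_ones_mat m) \<in> carrier_mat ((n + 1) * m) ((n + 1) * m)"
    by (simp add: kronecker_def all_ones_mat_def)
  ultimately have "A1_mat n m W l $$ (i * m + \<alpha>, j * m + \<gamma>) =
    N_mat n m W l $$ (i * m + \<alpha>, j * m + \<gamma>) - (if i = j then 1 else 0)"
    unfolding A1_mat_def using less by (subst index_minus_mat(1)) (simp_all only: carrier_matD)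
  then show "A1_mat n m W l $$ (i * m + \<alpha>, j * m + \<gamma>) =
    scheme_mat (\<lambda>_. 0) (residue_delta m l) $$ (i * m + \<alpha>, j * m + \<gamma>)"
    using idx assms by (simp add: N_entry scheme_mat_index entry_def residue_delta_def)
qed simp

lemma BGW_scheme_eq: "BGW_scheme n m W = scheme_list"
  unfolding BGW_scheme_def scheme_list_def
  by (auto simp: A0_mat_eq A1_mat_eq intro!: arg_cong2[where f = "(@)"])

end

theorem corollary4p8:
  fixes n m :: nat and W :: "complex mat option mat"
  assumes "n > 0" and "m > 0"
    and "BGW (cyclic_U m) (n + 1) n (n - 1) W"
    and "\<forall>i<n + 1. \<forall>j<n + 1. W $$ (i, j) = W $$ (j, i)"
    and "\<forall>i<n + 1. W $$ (i, i) = None"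
  shows "association_scheme ((n + 1) * m) (BGW_scheme n m W) \<and>
    (\<exists>T. is_character_table ((n + 1) * m) (BGW_scheme n m W) T) \<and>
    (\<forall>T. is_character_table ((n + 1) * m) (BGW_scheme n m W) T \<longrightarrow>
       (even m \<longrightarrow> eq_up_to_row_order T (table_even n m)) \<and>
       (odd m \<longrightarrow> eq_up_to_row_order T (table_odd n m)))"
proof -
  interpret symmetric_cyclic_BGW n m W
    by unfold_locales (fact assms)+
  let ?T = "if even m then table_even n m else table_odd n m"
  have "eq_up_to_row_order T ?T" if "is_character_table N scheme_list T" for T
    using that is_character_table_scheme_list matrix_algebra_scheme_algebra scheme_list_subset
    by (intro character_table_unique[of N scheme_list]) (simp_all only: adjacency_algebra_scheme_list)
  then show ?thesis
    using association_scheme_scheme_list is_character_table_scheme_list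
    unfolding BGW_scheme_eq N_def[symmetric] by (auto split: if_splits)
qed

end
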